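(* Every planar graph with girth at least $12$ is proper conflict-free (degree+$2$)-choosable.
   Context: All graphs are simple and finite. The girth is the length of a shortest cycle (infinite for acyclic graphs). A proper conflict-free coloring of a graph $G$ is a proper vertex coloring $\phi$ such that for every non-isolated vertex $v$ some color appears exactly once on the open neighborhood $N(v)$. For a non-negative integer $k$, $G$ is proper conflict-free (degree+$k$)-choosable if for every list assignment $L$ of $G$ with $|L(v)| = d_G(v)+k$ for all $v\in V(G)$, there is a proper conflict-free coloring $\phi$ of $G$ with $\phi(v)\in L(v)$ for all $v\in V(G)$. *)

theory Defs
  imports
    "HOL-Analysis.Analysis"
    "HOL-Library.Extended_Nat"
    "Graph_Theory.Graph_Theory"
begin

text \<open>
  A finite simple graph is a \<open>pair_graph\<close>: finite, loop-free, with a symmetric set of arcs, so an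
  edge between \<open>u\<close> and \<open>v\<close> is the pair of arcs \<open>(u, v)\<close>, \<open>(v, u)\<close>.
\<close>

definition neighborhood :: "'a pair_pre_digraph \<Rightarrow> 'a \<Rightarrow> 'a set" where
  "neighborhood G v = {u. (v, u) \<in> parcs G}"

definition degree :: "'a pair_pre_digraph \<Rightarrow> 'a \<Rightarrow> nat" where
  "degree G v = card (neighborhood G v)"

definition edges :: "'a pair_pre_digraph \<Rightarrow> 'a set set" where
  "edges G = {{u, v} | u v. (u, v) \<in> parcs G}"

text \<open>
  The bound \<open>3 \<le> length p\<close> excludes the closed walks \<open>u, v, u\<close>, which are cycles of the symmetric
  digraph but not of the undirected graph. The infimum of the empty set is \<open>\<infinity>\<close>.
\<close>

definition girth :: "'a pair_pre_digraph \<Rightarrow> enat" where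
  "girth G = (INF p \<in> {p. pre_digraph.cycle (with_proj G) p \<and> 3 \<le> length p}. enat (length p))"

text \<open>
  The interior \<open>path_image (\<gamma> e) - pos ` e\<close> of every drawn edge avoids all drawn vertices and all
  other drawn edges.
\<close>

definition plane_drawing ::
    "'a pair_pre_digraph \<Rightarrow> ('a \<Rightarrow> complex) \<Rightarrow> ('a set \<Rightarrow> real \<Rightarrow> complex) \<Rightarrow> bool" where
  "plane_drawing G pos \<gamma> \<longleftrightarrow>
     inj_on pos (pverts G) \<and>
     (\<forall>e \<in> edges G.
        arc (\<gamma> e) \<and>
        {pathstart (\<gamma> e), pathfinish (\<gamma> e)} = pos ` e \<and>
        (path_image (\<gamma> e) - pos ` e) \<inter> pos ` pverts G = {} \<and>
        (\<forall>f \<in> edges G. f \<noteq> e \<longrightarrow> (path_image (\<gamma> e) - pos ` e) \<inter> path_image (\<gamma> f) = {}))"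

definition planar :: "'a pair_pre_digraph \<Rightarrow> bool" where
  "planar G \<longleftrightarrow> (\<exists>pos \<gamma>. plane_drawing G pos \<gamma>)"

definition proper_coloring :: "'a pair_pre_digraph \<Rightarrow> ('a \<Rightarrow> 'c) \<Rightarrow> bool" where
  "proper_coloring G \<phi> \<longleftrightarrow> (\<forall>(u, v) \<in> parcs G. \<phi> u \<noteq> \<phi> v)"

definition proper_conflict_free_coloring :: "'a pair_pre_digraph \<Rightarrow> ('a \<Rightarrow> 'c) \<Rightarrow> bool" where
  "proper_conflict_free_coloring G \<phi> \<longleftrightarrow>
     proper_coloring G \<phi> \<and>
     (\<forall>v \<in> pverts G. neighborhood G v \<noteq> {} \<longrightarrow> (\<exists>c. \<exists>!u. u \<in> neighborhood G v \<and> \<phi> u = c))"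

text \<open>
  The colors come from the type \<open>'c\<close>. A definition cannot quantify over types, so the type is an
  argument; a theorem stated for a free type variable covers all color types.
\<close>

definition pcf_degree_plus_choosable ::
    "'c itself \<Rightarrow> nat \<Rightarrow> 'a pair_pre_digraph \<Rightarrow> bool" where
  "pcf_degree_plus_choosable T k G \<longleftrightarrow>
     (\<forall>L :: 'a \<Rightarrow> 'c set.
        (\<forall>v \<in> pverts G. finite (L v) \<and> card (L v) = degree G v + k) \<longrightarrow>
        (\<exists>\<phi>. proper_conflict_free_coloring G \<phi> \<and> (\<forall>v \<in> pverts G. \<phi> v \<in> L v)))"

end

theory Submission
  imports Defs
begin

text \<open>
  A plane graph with \<open>n\<close> vertices, \<open>m\<close> edges and girth at least \<open>g\<close> satisfies \<open>(g - 2) m \<le> g (n - 1)\<close>.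
  This needs no count of faces. For the part of the graph in the closed disc bounded by a cycle of
  length \<open>k\<close> the stronger bound \<open>(g - 2) m + k \<le> g (n - 1)\<close> holds: an ear of the cycle inside the disc
  splits the disc into two discs whose bounds add up exactly, and without ears one can split
  off a subgraph that meets the cycle in at most one vertex. Applied inside and, after an inversion
  of the plane, outside some cycle, it gives the general bound. For \<open>g = 12\<close> every subgraph has
  average degree below \<open>12/5\<close>.

  In a minimal counterexample the following are therefore impossible: a vertex of degree at most 1,
  four consecutive vertices of degree 2, a vertex of degree \<open>d \<ge> 3\<close> with \<open>d - 1\<close> neighbors that start
  paths of two vertices of degree 2, and a vertex of degree 3 with one such neighbor and another neighbor of
  degree 2. Each of these extends a coloring of the rest, because no short cycle joins the removed
  vertices. Discharging shows that average degree below \<open>12/5\<close> forces one of them.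
\<close>

hide_const (open) Digraph_Component.connected

section \<open>Paths and cycles\<close>

text \<open>The full girth 12 enters only through density: \<open>10 m + 12 \<le> 12 n\<close> for
  every nonempty induced subgraph, hence \<open>5 * 2 m < 12 n\<close>. The coloring arguments use
  girth 7, because a coincidence among the vertices in or next to a removed configuration would
  close a cycle of length at most 6. The configurations are shaped by the price of extending a
  coloring to a removed set \<open>S\<close>. For each neighbor \<open>x\<close> outside
  \<open>S\<close>, a vertex of \<open>S\<close> has to avoid two colors: the color of
  \<open>x\<close>, and a color that is unique around \<open>x\<close> and must stay so. Moreover a
  vertex of degree 2 is satisfied only if its two neighbors differ, so constraints reach to distance
  2 along paths of such vertices. The term \<open>k\<close> in the disc bound is what makes cutting
  along an ear exact: an ear edge is counted twice as an edge and lies on both new boundary cycles,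
  so its extra weight is \<open>(g - 2) + 2 = g\<close>, the weight of a vertex. An ear has one
  vertex more than it has edges, and that vertex pays for the constant \<open>g\<close> of the
  second disc.\<close>

fun pedges :: "'a list \<Rightarrow> 'a set set" where
  "pedges (x # y # zs) = insert {x, y} (pedges (y # zs))"
| "pedges _ = {}"

definition cyc :: "'a set set \<Rightarrow> 'a list \<Rightarrow> bool" where
  "cyc E p \<longleftrightarrow> 3 \<le> length p \<and> distinct p \<and> pedges (p @ [hd p]) \<subseteq> E"

lemma pedges_append: "pedges (xs @ v # ys) = pedges (xs @ [v]) \<union> pedges (v # ys)"
  by (induction xs rule: pedges.induct) auto

lemma pedges_snoc2: "pedges (xs @ [u, v]) = insert {u, v} (pedges (xs @ [u]))"
  using pedges_append[of xs u "[v]"] by simp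

lemma pedges_rev [simp]: "pedges (rev p) = pedges p"
  by (induction p rule: pedges.induct) (auto simp: pedges_snoc2 insert_commute)

lemma finite_pedges [simp]: "finite (pedges p)"
  by (induction p rule: pedges.induct) auto

lemma pedges_subset: "e \<in> pedges p \<Longrightarrow> e \<subseteq> set p"
  by (induction p rule: pedges.induct) auto

lemma Union_pedges: "2 \<le> length p \<Longrightarrow> \<Union> (pedges p) = set p"
proof (induction p rule: pedges.induct)
  case (1 x y zs)
  then show ?case by (cases zs) auto
qed auto

lemma card_pedges: "distinct p \<Longrightarrow> card (pedges p) = length p - 1"
proof (induction p rule: pedges.induct)
  case (1 x y zs)
  have "{x, y} \<notin> pedges (y # zs)"
    using 1(2) pedges_subset[of "{x, y}" "y # zs"] by auto
  then show ?case using 1 by simp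
qed auto

lemma card_pedges_closed:
  assumes "3 \<le> length p" "distinct p"
  shows "card (pedges (p @ [hd p])) = length p"
proof -
  obtain x y q where p: "p = x # y # q" and "q \<noteq> []"
    using assms(1) by (cases p; cases "tl p"; cases "tl (tl p)") auto
  then obtain r z where q: "q = r @ [z]"
    by (metis rev_exhaust)
  have eq: "pedges (p @ [hd p]) = insert {z, x} (pedges p)"
    unfolding p q using pedges_snoc2[of "x # y # r" z x] by simp
  \<comment> \<open>With at least three vertices the closing edge is not the first edge, as
    \<open>z \<noteq> y\<close>, and it is none of the later ones, which avoid
    \<open>x\<close>.\<close>
  have "{z, x} \<notin> pedges p"
  proof
    assume "{z, x} \<in> pedges p"
    then have "{z, x} = {x, y} \<or> {z, x} \<in> pedges (y # q)" by (simp add: p)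
    then show False
      using assms(2) pedges_subset[of "{z, x}" "y # q"] by (auto simp: p q doubleton_eq_iff)
  qed
  with eq show ?thesis using card_pedges[OF assms(2)] assms(1) by simp
qed

lemma pedges_rotate: "pedges ((xs @ ys) @ [hd (xs @ ys)]) = pedges ((ys @ xs) @ [hd (ys @ xs)])"
proof (cases "xs = [] \<or> ys = []")
  case False
  then obtain x xs' y ys' where [simp]: "xs = x # xs'" "ys = y # ys'"
    by (meson neq_Nil_conv)
  show ?thesis
    using pedges_append[of "x # xs'" y "ys' @ [x]"] pedges_append[of "y # ys'" x "xs' @ [y]"]
    by (simp add: Un_commute)
qed auto

text \<open>Both halves are read from \<open>a\<close> to \<open>b\<close>, hence
  \<open>rev ys\<close>, so that they can serve as two of the three paths of a theta graph. Their
  edge sets are disjoint by counting: their sizes add up to \<open>length C\<close>, which is also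
  the size of the union.\<close>

lemma cyc_split:
  assumes "cyc E C" "a \<in> set C" "b \<in> set C" "a \<noteq> b"
  obtains xs ys where "distinct (a # xs @ b # ys)" "set C = set (a # xs @ b # ys)"
    "length C = 2 + length xs + length ys"
    "pedges (C @ [hd C]) = pedges (a # xs @ [b]) \<union> pedges (a # rev ys @ [b])"
    "pedges (a # xs @ [b]) \<inter> pedges (a # rev ys @ [b]) = {}"
    "xs \<noteq> [] \<or> ys \<noteq> []"
proof -
  obtain us vs where C: "C = us @ a # vs" using assms(2) by (meson split_list)
  have "b \<in> set (vs @ us)" using assms(3,4) C by auto
  then obtain xs ys where vu: "vs @ us = xs @ b # ys" by (meson split_list)
  have "pedges (C @ [hd C]) = pedges (((a # vs) @ us) @ [hd ((a # vs) @ us)])"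
    unfolding C by (rule pedges_rotate)
  also have "\<dots> = pedges ((a # xs) @ b # ys @ [a])" using vu by simp
  also have "\<dots> = pedges (a # xs @ [b]) \<union> pedges (b # ys @ [a])"
    by (subst pedges_append) simp
  also have "pedges (b # ys @ [a]) = pedges (a # rev ys @ [b])"
    using pedges_rev[of "b # ys @ [a]"] by simp
  finally have e: "pedges (C @ [hd C]) = pedges (a # xs @ [b]) \<union> pedges (a # rev ys @ [b])" .
  have m: "mset C = mset (a # xs @ b # ys)"
    unfolding C using arg_cong[OF vu, of mset] by (simp add: union_commute)
  have l: "length C = 2 + length xs + length ys" using mset_eq_length[OF m] by simp
  have d: "distinct (a # xs @ b # ys)"
    using mset_eq_imp_distinct_iff[OF m] assms(1) by (simp add: cyc_def)
  have "card (pedges (a # xs @ [b]) \<union> pedges (a # rev ys @ [b])) = length C"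
    using card_pedges_closed[of C] assms(1) e by (simp add: cyc_def)
  moreover have "card (pedges (a # xs @ [b])) + card (pedges (a # rev ys @ [b])) = length C"
    using card_pedges[of "a # xs @ [b]"] card_pedges[of "a # rev ys @ [b]"] d l by auto
  ultimately have "card (pedges (a # xs @ [b]) \<inter> pedges (a # rev ys @ [b])) = 0"
    using card_Un_Int[of "pedges (a # xs @ [b])" "pedges (a # rev ys @ [b])"] by simp
  then have i: "pedges (a # xs @ [b]) \<inter> pedges (a # rev ys @ [b]) = {}" by simp
  show thesis
  proof (rule that[OF d _ l e i])
    show "set C = set (a # xs @ b # ys)" using mset_eq_setD[OF m] .
    show "xs \<noteq> [] \<or> ys \<noteq> []" using l assms(1) by (auto simp: cyc_def)
  qed
qed

lemma cyc_mono: "cyc E p \<Longrightarrow> E \<subseteq> F \<Longrightarrow> cyc F p"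
  by (auto simp: cyc_def)

lemma cyc_join:
  assumes "distinct (a # xs @ b # ys)" "xs \<noteq> [] \<or> ys \<noteq> []"
    "pedges (a # xs @ [b]) \<subseteq> E" "pedges (a # rev ys @ [b]) \<subseteq> E"
  shows "cyc E (a # xs @ b # ys)"
    and "pedges ((a # xs @ b # ys) @ [hd (a # xs @ b # ys)])
      = pedges (a # xs @ [b]) \<union> pedges (a # rev ys @ [b])"
proof -
  have "pedges ((a # xs @ b # ys) @ [a]) = pedges (a # xs @ [b]) \<union> pedges (b # ys @ [a])"
    using pedges_append[of "a # xs" b "ys @ [a]"] by simp
  also have "pedges (b # ys @ [a]) = pedges (a # rev ys @ [b])"
    using pedges_rev[of "b # ys @ [a]"] by simp
  finally show *: "pedges ((a # xs @ b # ys) @ [hd (a # xs @ b # ys)])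
      = pedges (a # xs @ [b]) \<union> pedges (a # rev ys @ [b])" by simp
  have "3 \<le> length (a # xs @ b # ys)" using assms(2) by (cases xs; cases ys) auto
  with * assms show "cyc E (a # xs @ b # ys)" unfolding cyc_def by auto
qed

text \<open>The path grows along the reachability proof. If the next vertex already lies on it, the
  path is cut there instead of prolonged, which keeps it simple.\<close>

lemma reachable_distinct_path:
  assumes "(s, t) \<in> {(x, y). {x, y} \<in> E \<and> x \<notin> C \<and> y \<notin> C}\<^sup>*" "s \<notin> C"
  shows "\<exists>p. p \<noteq> [] \<and> hd p = s \<and> last p = t \<and> distinct p \<and> pedges p \<subseteq> E \<and> set p \<inter> C = {}"
  using assms(1)
proof (induction rule: rtrancl_induct)
  case base
  show ?case by (rule exI[of _ "[s]"]) (use assms(2) in auto)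
next
  case (step y z)
  then obtain p where p: "p \<noteq> []" "hd p = s" "last p = y" "distinct p" "pedges p \<subseteq> E"
    "set p \<inter> C = {}" by blast
  have yz: "{y, z} \<in> E" "z \<notin> C" using step(2) by auto
  show ?case
  proof (cases "z \<in> set p")
    case True
    then obtain us vs where us: "p = us @ z # vs" by (meson split_list)
    have "pedges (us @ [z]) \<subseteq> E" using p(5) pedges_append[of us z vs] us by auto
    then show ?thesis using p us
      by (intro exI[of _ "us @ [z]"]) (auto simp: hd_append)
  next
    case False
    obtain q where q: "p = q @ [y]" using p(1,3) by (metis append_butlast_last_id)
    have "pedges (p @ [z]) \<subseteq> E" using p(5) yz by (simp add: q pedges_snoc2)
    then show ?thesis using p False yz
      by (intro exI[of _ "p @ [z]"]) auto
  qed
qed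

section \<open>Forests: the case of the edge bound without a cycle\<close>

text \<open>Take an end \<open>x\<close> of a longest path: a second edge at \<open>x\<close> would
  either close a cycle with a part of the path or prolong it.\<close>

lemma acyclic_leaf:
  assumes fin: "finite V" and E: "\<And>e. e \<in> E \<Longrightarrow> e \<subseteq> V \<and> card e = 2"
    and "E \<noteq> {}" and acyc: "\<And>p. \<not> cyc E p"
  shows "\<exists>x y. {e \<in> E. x \<in> e} = {{x, y}} \<and> x \<in> V"
proof -
  define P where "P = (\<lambda>p. 2 \<le> length p \<and> distinct p \<and> pedges p \<subseteq> E)"
  have bound: "length p \<le> card V" if "P p" for p
  proof -
    have "set p \<subseteq> V" using Union_pedges[of p] that E by (auto simp: P_def)
    then show ?thesis using that fin distinct_card[of p] card_mono[of V "set p"] by (auto simp: P_def)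
  qed
  obtain e where e: "e \<in> E" using assms(3) by auto
  then obtain u v where "e = {u, v}" "u \<noteq> v" using E by (meson card_2_iff)
  then have "P [u, v]" using e by (auto simp: P_def)
  then obtain p where p: "P p" and max: "\<And>q. P q \<Longrightarrow> length q \<le> length p"
    using ex_has_greatest_nat[of P "[u, v]" length "Suc (card V)"] bound
    by (metis less_Suc_eq_le)
  obtain x y zs where xy: "p = x # y # zs" using p by (cases p; cases "tl p") (auto simp: P_def)
  have xyE: "{x, y} \<in> E" using p by (auto simp: P_def xy)
  have "f = {x, y}" if f: "f \<in> E" "x \<in> f" for f
  proof (rule ccontr)
    assume ne: "f \<noteq> {x, y}"
    obtain w where w: "f = {x, w}" "w \<noteq> x" using f E[of f] by (auto simp: card_2_iff)
    show False
    proof (cases "w \<in> set p")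
      case True
      then have "w \<in> set zs" using w ne by (auto simp: xy)
      then obtain us vs where zs: "zs = us @ w # vs" by (meson split_list)
      have "pedges (x # y # us @ [w]) \<subseteq> E"
        using p pedges_append[of "x # y # us" w vs] unfolding P_def xy zs append_Cons by blast
      then have "pedges ((x # y # us @ [w]) @ [x]) \<subseteq> E"
        using pedges_snoc2[of "x # y # us" w x] f w by (auto simp: insert_commute)
      then have "cyc E (x # y # us @ [w])" using p by (auto simp: P_def xy zs cyc_def)
      then show False using acyc by blast
    next
      case False
      then have "P (w # p)" using p f w by (auto simp: P_def xy insert_commute)
      then show False using max by fastforce
    qed
  qed
  then have "{e \<in> E. x \<in> e} = {{x, y}}" using xyE by blast
  moreover have "x \<in> V" using E[OF xyE] by blast
  ultimately show ?thesis by blast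
qed

lemma acyclic_card_edges:
  assumes "finite V" "\<And>e. e \<in> E \<Longrightarrow> e \<subseteq> V \<and> card e = 2" "V \<noteq> {}" "\<And>p. \<not> cyc E p"
  shows "card E < card V"
  using assms
proof (induction "card V" arbitrary: V E rule: less_induct)
  case less
  show ?case
  proof (cases "E = {}")
    case True
    then show ?thesis using less.prems by (simp add: card_gt_0_iff)
  next
    case False
    obtain x y where xy: "{e \<in> E. x \<in> e} = {{x, y}}" "x \<in> V"
      using acyclic_leaf[OF less.prems(1,2) False less.prems(4)] by blast
    define E' where "E' = E - {{x, y}}"
    have "finite E" using less.prems(1,2) by (metis Pow_iff finite_Pow_iff finite_subset subsetI)
    moreover have xyE: "{x, y} \<in> E" using xy by auto
    ultimately have cE: "card E = Suc (card E')"
      unfolding E'_def by (metis card.remove)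
    have "{x, y} \<subseteq> V" "card {x, y} = 2" using less.prems(2)[OF xyE] by auto
    then have y: "y \<in> V - {x}" by auto
    have "card E' < card (V - {x})"
    proof (rule less.hyps)
      show "card (V - {x}) < card V" using xy less.prems(1) by (metis card_Diff1_less)
      show "finite (V - {x})" using less.prems(1) by simp
      show "V - {x} \<noteq> {}" using y by auto
      show "e \<subseteq> V - {x} \<and> card e = 2" if "e \<in> E'" for e
        using that xy less.prems(2)[of e] unfolding E'_def by blast
      show "\<not> cyc E' p" for p using less.prems(4)[of p] cyc_mono[of E' p E] E'_def by auto
    qed
    moreover have "card V = Suc (card (V - {x}))"
      using xy(2) less.prems(1) by (metis card.remove)
    ultimately show ?thesis using cE by linarith
  qed
qed

section \<open>Drawings of paths and cycles\<close>

text \<open>The conditions of \<open>plane_drawing\<close> with vertices and edges as bare sets, so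
  that a part of a drawing is obtained by shrinking \<open>V\<close> and \<open>E\<close> while
  \<open>pos\<close> and \<open>\<gamma>\<close> stay the same.\<close>

definition plane_graph ::
    "'a set \<Rightarrow> 'a set set \<Rightarrow> ('a \<Rightarrow> complex) \<Rightarrow> ('a set \<Rightarrow> real \<Rightarrow> complex) \<Rightarrow> bool" where
  "plane_graph V E pos \<gamma> \<longleftrightarrow>
     finite V \<and> (\<forall>e \<in> E. e \<subseteq> V \<and> card e = 2) \<and> inj_on pos V \<and>
     (\<forall>e \<in> E. arc (\<gamma> e) \<and> {pathstart (\<gamma> e), pathfinish (\<gamma> e)} = pos ` e \<and>
        (path_image (\<gamma> e) - pos ` e) \<inter> pos ` V = {} \<and>
        (\<forall>f \<in> E. f \<noteq> e \<longrightarrow> (path_image (\<gamma> e) - pos ` e) \<inter> path_image (\<gamma> f) = {}))"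

definition drawn :: "('a set \<Rightarrow> real \<Rightarrow> complex) \<Rightarrow> 'a set set \<Rightarrow> complex set" where
  "drawn \<gamma> D = (\<Union>e\<in>D. path_image (\<gamma> e))"

lemma drawn_Un: "drawn \<gamma> (D \<union> D') = drawn \<gamma> D \<union> drawn \<gamma> D'"
  by (auto simp: drawn_def)

lemma plane_graph_subset:
  assumes "plane_graph V E pos \<gamma>" "V' \<subseteq> V" "E' \<subseteq> E" "\<And>e. e \<in> E' \<Longrightarrow> e \<subseteq> V'"
  shows "plane_graph V' E' pos \<gamma>"
  unfolding plane_graph_def
proof (intro conjI ballI impI)
  note pg = assms(1)[unfolded plane_graph_def]
  show "finite V'" using pg assms(2) by (meson finite_subset)
  show "inj_on pos V'" using pg assms(2) by (meson inj_on_subset)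
  fix e assume e: "e \<in> E'"
  then have eE: "e \<in> E" using assms(3) by auto
  show "e \<subseteq> V'" using assms(4)[OF e] .
  show "card e = 2" "arc (\<gamma> e)" "{pathstart (\<gamma> e), pathfinish (\<gamma> e)} = pos ` e"
    using pg eE by simp_all
  have "(path_image (\<gamma> e) - pos ` e) \<inter> pos ` V = {}" using pg eE by simp
  then show "(path_image (\<gamma> e) - pos ` e) \<inter> pos ` V' = {}"
    using image_mono[OF assms(2), of pos] by blast
  fix f assume "f \<in> E'" "f \<noteq> e"
  then show "(path_image (\<gamma> e) - pos ` e) \<inter> path_image (\<gamma> f) = {}"
    using pg eE assms(3) by (simp add: subset_eq)
qed

text \<open>Transfers the position of an open edge relative to a closed curve to the whole edge,
  including its ends.\<close>

lemma path_image_subset_closure_endless: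
  fixes c :: "real \<Rightarrow> 'a::real_normed_vector"
  assumes "simple_path c"
  shows "path_image c \<subseteq> closure (path_image c - {pathstart c, pathfinish c})"
proof -
  have "continuous_on (closure {0<..<1}) c"
    using assms by (simp add: simple_path_def path_def)
  then have "c ` closure {0<..<1} \<subseteq> closure (c ` {0<..<1})"
    by (rule image_closure_subset) (auto simp: closure_subset)
  then show ?thesis using simple_path_endless[OF assms] by (simp add: path_image_def)
qed

lemma connected_disjoint_inside_or_outside:
  assumes "connected S" "S \<inter> K = {}"
  shows "S \<subseteq> inside K \<or> S \<subseteq> outside K"
proof (cases "S \<inter> inside K = {}")
  case True
  moreover have "S \<subseteq> inside K \<union> outside K" using assms(2) by (auto simp: inside_Un_outside)
  ultimately show ?thesis by blast
next
  case False
  then obtain x where x: "x \<in> S" "x \<in> inside K" by auto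
  have "S \<subseteq> inside K"
  proof
    fix y assume "y \<in> S"
    then have "connected_component (- K) x y"
      using assms x unfolding connected_component_def by blast
    then show "y \<in> inside K" using inside_same_component x by metis
  qed
  then show ?thesis by simp
qed

context
  fixes V :: "'a set" and E pos \<gamma>
  assumes pg: "plane_graph V E pos \<gamma>"
begin

lemma
  shows pg_finV: "finite V"
    and pg_edge: "e \<in> E \<Longrightarrow> e \<subseteq> V" "e \<in> E \<Longrightarrow> card e = 2"
    and pg_inj: "inj_on pos V"
    and pg_arc: "e \<in> E \<Longrightarrow> arc (\<gamma> e)"
    and pg_ends: "e \<in> E \<Longrightarrow> {pathstart (\<gamma> e), pathfinish (\<gamma> e)} = pos ` e"
    and pg_vertex: "e \<in> E \<Longrightarrow> (path_image (\<gamma> e) - pos ` e) \<inter> pos ` V = {}"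
    and pg_cross: "e \<in> E \<Longrightarrow> f \<in> E \<Longrightarrow> f \<noteq> e \<Longrightarrow> (path_image (\<gamma> e) - pos ` e) \<inter> path_image (\<gamma> f) = {}"
  using pg unfolding plane_graph_def by auto

lemma pg_finE: "finite E"
proof -
  have "E \<subseteq> Pow V" using pg_edge by auto
  then show ?thesis using pg_finV by (meson finite_Pow_iff finite_subset)
qed

lemma pos_edge_subset: "e \<in> E \<Longrightarrow> pos ` e \<subseteq> path_image (\<gamma> e)"
  using pathstart_in_path_image[of "\<gamma> e"] pathfinish_in_path_image[of "\<gamma> e"]
  by (simp add: pg_ends[symmetric])

text \<open>The crossing condition is one-sided, the interior of one edge against all of the other.
  Used in both directions it leaves only points that are ends of both edges.\<close>

lemma edge_image_inter:
  assumes "e \<in> E" "f \<in> E" "e \<noteq> f"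
  shows "path_image (\<gamma> e) \<inter> path_image (\<gamma> f) \<subseteq> pos ` (e \<inter> f)"
proof -
  have "path_image (\<gamma> e) \<inter> path_image (\<gamma> f) \<subseteq> pos ` e \<inter> pos ` f"
    using pg_cross[of e f] pg_cross[of f e] assms by blast
  then show ?thesis
    using inj_on_image_Int[OF pg_inj pg_edge(1) pg_edge(1), OF assms(1,2)] by simp
qed

lemma drawn_inter:
  assumes "D \<subseteq> E" "D' \<subseteq> E" "D \<inter> D' = {}"
  shows "drawn \<gamma> D \<inter> drawn \<gamma> D' \<subseteq> pos ` (\<Union> D \<inter> \<Union> D')"
proof
  fix z assume "z \<in> drawn \<gamma> D \<inter> drawn \<gamma> D'"
  then obtain e f where ef: "e \<in> D" "f \<in> D'" "z \<in> path_image (\<gamma> e) \<inter> path_image (\<gamma> f)"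
    by (auto simp: drawn_def)
  then have "e \<in> E" "f \<in> E" "e \<noteq> f" using assms by auto
  then show "z \<in> pos ` (\<Union> D \<inter> \<Union> D')" using edge_image_inter[of e f] ef by blast
qed

lemma pos_in_drawn:
  assumes "D \<subseteq> E" "v \<in> V"
  shows "pos v \<in> drawn \<gamma> D \<longleftrightarrow> v \<in> \<Union> D"
proof
  assume "pos v \<in> drawn \<gamma> D"
  then obtain e where e: "e \<in> D" "pos v \<in> path_image (\<gamma> e)" by (auto simp: drawn_def)
  then have eE: "e \<in> E" using assms by auto
  have "pos v \<in> pos ` e" using pg_vertex[OF eE] e(2) assms(2) by blast
  then have "v \<in> e" using inj_on_image_mem_iff[OF pg_inj assms(2) pg_edge(1)[OF eE]] by simp
  then show "v \<in> \<Union> D" using e by auto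
next
  assume "v \<in> \<Union> D"
  then show "pos v \<in> drawn \<gamma> D" using pos_edge_subset assms by (auto simp: drawn_def)
qed

lemma edge_interior:
  assumes "e \<in> E"
  defines "I \<equiv> path_image (\<gamma> e) - pos ` e"
  shows "connected I" "I \<noteq> {}" "path_image (\<gamma> e) \<subseteq> closure I"
proof -
  have "simple_path (\<gamma> e)" using pg_arc[OF assms(1)] by (rule arc_imp_simple_path)
  then show "connected I" "I \<noteq> {}" "path_image (\<gamma> e) \<subseteq> closure I"
    using connected_simple_path_endless nonempty_simple_path_endless
      path_image_subset_closure_endless pg_ends[OF assms(1)] unfolding I_def by metis+
qed

lemma edge_interior_disjoint:
  assumes "e \<in> E" "D \<subseteq> E" "e \<notin> D"
  shows "(path_image (\<gamma> e) - pos ` e) \<inter> drawn \<gamma> D = {}"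
  using pg_cross[OF assms(1)] assms(2,3) unfolding drawn_def by blast

lemma closed_drawn: "D \<subseteq> E \<Longrightarrow> closed (drawn \<gamma> D)"
  unfolding drawn_def
  by (intro closed_UN) (auto intro: closed_arc_image pg_arc finite_subset[OF _ pg_finE])

text \<open>The open edge is connected and misses \<open>K\<close>, so it stays on one side; passing
  to the closure adds at most points of \<open>K\<close>.\<close>

lemma edge_inside_or_outside:
  assumes "e \<in> E" "D \<subseteq> E" "e \<notin> D"
  defines "K \<equiv> drawn \<gamma> D" and "I \<equiv> path_image (\<gamma> e) - pos ` e"
  shows "(path_image (\<gamma> e) \<subseteq> K \<union> inside K \<and> I \<subseteq> inside K) \<or>
         (path_image (\<gamma> e) \<subseteq> K \<union> outside K \<and> I \<subseteq> outside K)"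
proof -
  have cl: "path_image (\<gamma> e) \<subseteq> closure I" and c: "connected I"
    using edge_interior[OF assms(1)] by (auto simp: I_def)
  have K: "closed K" unfolding K_def using closed_drawn assms(2) .
  have "I \<subseteq> inside K \<or> I \<subseteq> outside K"
    using connected_disjoint_inside_or_outside[OF c] edge_interior_disjoint[OF assms(1-3)]
    by (simp add: I_def K_def)
  then show ?thesis
    using cl closure_mono[of I "inside K"] closure_mono[of I "outside K"]
      closure_inside_subset[OF K] closure_outside_subset[OF K] by blast
qed

text \<open>A drawn edge may run in either direction, so each is reversed where necessary before
  joining. The joins are arcs because the first edge shares only the vertex \<open>y\<close> with
  the rest of the path.\<close>

lemma path_arc:
  assumes "2 \<le> length p" "distinct p" "pedges p \<subseteq> E"
  shows "\<exists>h. arc h \<and> pathstart h = pos (hd p) \<and> pathfinish h = pos (last p) \<and>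
           path_image h = drawn \<gamma> (pedges p)"
  using assms
proof (induction p rule: pedges.induct)
  case (1 x y zs)
  have xy: "{x, y} \<in> E" using 1(4) by simp
  have "{pathstart (\<gamma> {x, y}), pathfinish (\<gamma> {x, y})} = {pos x, pos y}" using pg_ends[OF xy] by simp
  then consider "pathstart (\<gamma> {x, y}) = pos x" "pathfinish (\<gamma> {x, y}) = pos y"
    | "pathstart (\<gamma> {x, y}) = pos y" "pathfinish (\<gamma> {x, y}) = pos x"
    by (auto simp: doubleton_eq_iff)
  then obtain g where g: "arc g" "pathstart g = pos x" "pathfinish g = pos y"
    "path_image g = path_image (\<gamma> {x, y})"
  proof cases
    case 2
    then show ?thesis using that[of "reversepath (\<gamma> {x, y})"] pg_arc[OF xy]
      by (simp add: arc_reversepath)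
  qed (use pg_arc[OF xy] in auto)
  show ?case
  proof (cases zs)
    case Nil
    then show ?thesis using g by (intro exI[of _ g]) (simp add: drawn_def)
  next
    case (Cons z zs')
    then obtain h where h: "arc h" "pathstart h = pos y" "pathfinish h = pos (last (y # zs))"
      "path_image h = drawn \<gamma> (pedges (y # zs))"
      using 1 by auto
    have "{x, y} \<notin> pedges (y # zs)" using 1(3) pedges_subset[of "{x, y}" "y # zs"] by auto
    then have "drawn \<gamma> {{x, y}} \<inter> drawn \<gamma> (pedges (y # zs)) \<subseteq> pos ` ({x, y} \<inter> \<Union> (pedges (y # zs)))"
      using drawn_inter[of "{{x, y}}" "pedges (y # zs)"] 1(4) by simp
    also have "\<dots> \<subseteq> {pos y}" using 1(3) pedges_subset[of _ "y # zs"] by fastforce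
    finally have "path_image g \<inter> path_image h \<subseteq> {pathstart h}"
      using g h by (simp add: drawn_def)
    then have "arc (g +++ h)" using g h by (simp add: arc_join)
    then show ?thesis using g h
      by (intro exI[of _ "g +++ h"]) (simp add: path_image_join drawn_def)
  qed
qed auto

lemma two_paths_curve:
  assumes "distinct (a # xs @ b # ys)"
    and X: "pedges (a # xs @ [b]) \<subseteq> E" and Y: "pedges (a # ys @ [b]) \<subseteq> E"
    and dis: "pedges (a # xs @ [b]) \<inter> pedges (a # ys @ [b]) = {}"
  shows "drawn \<gamma> (pedges (a # xs @ [b])) \<inter> drawn \<gamma> (pedges (a # ys @ [b])) = {pos a, pos b}"
proof
  have "\<Union> (pedges (a # xs @ [b])) = insert a (insert b (set xs))"
    "\<Union> (pedges (a # ys @ [b])) = insert a (insert b (set ys))"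
    using Union_pedges[of "a # xs @ [b]"] Union_pedges[of "a # ys @ [b]"] by auto
  moreover from this have "\<Union> (pedges (a # xs @ [b])) \<inter> \<Union> (pedges (a # ys @ [b])) = {a, b}"
    using assms(1) by auto
  moreover have "a \<in> V" "b \<in> V" using calculation pg_edge(1) X by blast+
  ultimately show "drawn \<gamma> (pedges (a # xs @ [b])) \<inter> drawn \<gamma> (pedges (a # ys @ [b])) \<subseteq> {pos a, pos b}"
    "{pos a, pos b} \<subseteq> drawn \<gamma> (pedges (a # xs @ [b])) \<inter> drawn \<gamma> (pedges (a # ys @ [b]))"
    using drawn_inter[OF X Y dis] pos_in_drawn[OF X] pos_in_drawn[OF Y] by auto
qed

text \<open>Cut at its first two vertices, the cycle becomes two arcs with common ends; one followed
  by the reverse of the other is a simple closed curve.\<close>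

lemma cycle_curve:
  assumes "cyc E C"
  shows "\<exists>c. simple_path c \<and> pathfinish c = pathstart c \<and> path_image c = drawn \<gamma> (pedges (C @ [hd C]))"
proof -
  obtain a b r where C: "C = a # b # r" "r \<noteq> []"
    using assms by (cases C; cases "tl C"; cases "tl (tl C)") (auto simp: cyc_def)
  have d: "distinct C" using assms by (simp add: cyc_def)
  then have "a \<noteq> b" using C by simp
  with assms C obtain xs ys where s: "distinct (a # xs @ b # ys)"
    "pedges (C @ [hd C]) = pedges (a # xs @ [b]) \<union> pedges (a # rev ys @ [b])"
    "pedges (a # xs @ [b]) \<inter> pedges (a # rev ys @ [b]) = {}"
    using cyc_split[of E C a b] by (metis list.set_intros)
  have X: "pedges (a # xs @ [b]) \<subseteq> E" and Y: "pedges (a # rev ys @ [b]) \<subseteq> E"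
    using assms s by (auto simp: cyc_def)
  obtain g where g: "arc g" "pathstart g = pos a" "pathfinish g = pos b"
    "path_image g = drawn \<gamma> (pedges (a # xs @ [b]))"
    using path_arc[OF _ _ X] s by auto
  obtain h where h: "arc h" "pathstart h = pos a" "pathfinish h = pos b"
    "path_image h = drawn \<gamma> (pedges (a # rev ys @ [b]))"
    using path_arc[OF _ _ Y] s by auto
  have "path_image g \<inter> path_image h = {pos a, pos b}"
    using two_paths_curve[of a xs b "rev ys"] s X Y g h by auto
  then have "simple_path (g +++ reversepath h)"
    using g h by (intro simple_path_join_loop) (auto simp: arc_reversepath)
  then show ?thesis
    using g h s by (intro exI[of _ "g +++ reversepath h"]) (simp add: path_image_join drawn_Un)
qed

text \<open>The theta-curve form of the Jordan curve theorem, transferred from arcs to drawn paths.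
  Hypothesis \<open>ins\<close> singles out \<open>P\<close> as the middle one of the three
  paths.\<close>

lemma theta_inside:
  fixes a b xs ys ps
  defines "X \<equiv> pedges (a # xs @ [b])" and "Y \<equiv> pedges (a # ys @ [b])" and "P \<equiv> pedges (a # ps @ [b])"
  assumes dist: "distinct (a # xs @ b # ys)" "distinct (a # xs @ b # ps)" "distinct (a # ys @ b # ps)"
    and E: "X \<subseteq> E" "Y \<subseteq> E" "P \<subseteq> E"
    and dis: "X \<inter> Y = {}" "X \<inter> P = {}" "Y \<inter> P = {}"
    and ins: "drawn \<gamma> P \<inter> inside (drawn \<gamma> (X \<union> Y)) \<noteq> {}"
  shows "inside (drawn \<gamma> (X \<union> P)) \<inter> inside (drawn \<gamma> (Y \<union> P)) = {}"
    and "inside (drawn \<gamma> (X \<union> P)) \<union> inside (drawn \<gamma> (Y \<union> P)) \<union> (drawn \<gamma> P - {pos a, pos b})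
      = inside (drawn \<gamma> (X \<union> Y))"
proof -
  obtain c1 where c1: "arc c1" "pathstart c1 = pos a" "pathfinish c1 = pos b" "path_image c1 = drawn \<gamma> X"
    using path_arc[of "a # xs @ [b]"] dist E by (auto simp: X_def)
  obtain c2 where c2: "arc c2" "pathstart c2 = pos a" "pathfinish c2 = pos b" "path_image c2 = drawn \<gamma> Y"
    using path_arc[of "a # ys @ [b]"] dist E by (auto simp: Y_def)
  obtain c where c: "arc c" "pathstart c = pos a" "pathfinish c = pos b" "path_image c = drawn \<gamma> P"
    using path_arc[of "a # ps @ [b]"] dist E by (auto simp: P_def)
  have "path_image c1 \<inter> path_image c2 = {pos a, pos b}" "path_image c1 \<inter> path_image c = {pos a, pos b}"
    "path_image c2 \<inter> path_image c = {pos a, pos b}"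
    using two_paths_curve dist E dis c1(4) c2(4) c(4) unfolding X_def Y_def P_def by metis+
  moreover have "pos a \<noteq> pos b" using c arc_distinct_ends[of c] by auto
  moreover have "path_image c \<inter> inside (path_image c1 \<union> path_image c2) \<noteq> {}"
    using ins c1 c2 c by (simp add: drawn_Un)
  ultimately show "inside (drawn \<gamma> (X \<union> P)) \<inter> inside (drawn \<gamma> (Y \<union> P)) = {}"
    "inside (drawn \<gamma> (X \<union> P)) \<union> inside (drawn \<gamma> (Y \<union> P)) \<union> (drawn \<gamma> P - {pos a, pos b})
      = inside (drawn \<gamma> (X \<union> Y))"
    using split_inside_simple_closed_curve[OF arc_imp_simple_path[OF c1(1)] c1(2,3)
        arc_imp_simple_path[OF c2(1)] c2(2,3) arc_imp_simple_path[OF c(1)] c(2,3)]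
    by (metis c1(4) c2(4) c(4) drawn_Un)+
qed

text \<open>Inversion about a point \<open>w\<close> inside a cycle turns the part outside the cycle
  into a part inside it, so that one bound for discs covers both sides.\<close>

lemma plane_graph_inversion:
  assumes "w \<notin> pos ` V" "w \<notin> drawn \<gamma> E"
  defines "f \<equiv> \<lambda>z. inverse (z - w)"
  shows "plane_graph V E (f \<circ> pos) (\<lambda>e. f \<circ> \<gamma> e)"
proof -
  \<comment> \<open>Injective on the whole plane, including \<open>w\<close>: by
    \<open>inverse 0 = 0\<close> the point \<open>w\<close> goes to \<open>0\<close>, which no other
    point reaches. Only continuity fails at \<open>w\<close>.\<close>
  have inj: "inj f" by (auto simp: f_def inj_on_def)
  have cont: "continuous_on (path_image (\<gamma> e)) f" if "e \<in> E" for e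
    using that assms(2) unfolding f_def by (intro continuous_intros) (auto simp: drawn_def)
  have "arc (f \<circ> \<gamma> e)" if "e \<in> E" for e
  proof -
    have "path (f \<circ> \<gamma> e)"
      using path_continuous_image[OF arc_imp_path cont] pg_arc that by blast
    moreover have "inj_on (f \<circ> \<gamma> e) {0..1}"
      using pg_arc[OF that] inj by (auto simp: arc_def intro: comp_inj_on inj_on_subset)
    ultimately show ?thesis by (simp add: arc_def)
  qed
  moreover have "{pathstart (f \<circ> \<gamma> e), pathfinish (f \<circ> \<gamma> e)} = (f \<circ> pos) ` e" if "e \<in> E" for e
    using arg_cong[OF pg_ends[OF that], of "image f"] by (simp add: pathstart_compose pathfinish_compose image_comp)
  moreover have im: "path_image (f \<circ> \<gamma> e) - (f \<circ> pos) ` e = f ` (path_image (\<gamma> e) - pos ` e)" for e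
    using inj by (simp add: path_image_compose image_set_diff image_comp)
  moreover have "f ` (path_image (\<gamma> e) - pos ` e) \<inter> (f \<circ> pos) ` V = {}" if "e \<in> E" for e
    using pg_vertex[OF that] unfolding image_comp[symmetric] image_Int[OF inj, symmetric] by simp
  moreover have "f ` (path_image (\<gamma> e) - pos ` e) \<inter> path_image (f \<circ> \<gamma> e') = {}"
    if "e \<in> E" "e' \<in> E" "e' \<noteq> e" for e e'
    using pg_cross[OF that] unfolding path_image_compose image_Int[OF inj, symmetric] by simp
  moreover have "inj_on (f \<circ> pos) V"
    using pg_inj inj by (auto intro: comp_inj_on inj_on_subset)
  ultimately show ?thesis using pg_finV pg_edge unfolding plane_graph_def by simp
qed

end

text \<open>
  If \<open>z\<close> were mapped to the outside of the image curve, a connected set avoiding the image curve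
  and \<open>0\<close> would join it to points near infinity, that is, to images of points near \<open>w\<close>.
\<close>

lemma inversion_outside:
  fixes c :: "real \<Rightarrow> complex"
  assumes "simple_path c" "pathfinish c = pathstart c" "w \<in> inside (path_image c)" "z \<in> outside (path_image c)"
  defines "f \<equiv> \<lambda>z. inverse (z - w)"
  shows "f z \<in> inside (f ` path_image c)"
proof (rule ccontr)
  define K where "K = path_image c"
  define K' where "K' = f ` K"
  define h where "h = (\<lambda>u. w + inverse u)"
  have wK: "w \<notin> K" using assms(3) inside_no_overlap unfolding K_def by blast
  have "inj f" by (auto simp: f_def inj_on_def)
  have contf: "continuous_on K f" unfolding f_def using wK by (intro continuous_intros) auto
  have "simple_path (f \<circ> c)"
    using simple_path_continuous_image[OF assms(1)] contf \<open>inj f\<close> unfolding K_def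
    by (meson inj_on_subset subset_UNIV)
  moreover have "pathfinish (f \<circ> c) = pathstart (f \<circ> c)"
    using assms(2) by (simp add: pathstart_compose pathfinish_compose)
  ultimately have J: "open (outside K')" "connected (outside K')"
    using Jordan_inside_outside[of "f \<circ> c"] by (auto simp: K'_def K_def path_image_compose)
  have zK: "z \<notin> K" using assms(4) outside_no_overlap unfolding K_def by blast
  have "z \<noteq> w" using assms(3,4) inside_Int_outside by blast
  then have fz: "f z \<noteq> 0" "h (f z) = z" by (auto simp: f_def h_def)
  assume "f z \<notin> inside (f ` path_image c)"
  moreover have "f z \<notin> K'" using zK \<open>inj f\<close> by (auto simp: K'_def inj_image_mem_iff)
  ultimately have fzo: "f z \<in> outside K'" using inside_Un_outside[of K'] unfolding K'_def K_def by blast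
  have "compact K'" unfolding K'_def K_def
    using contf compact_simple_path_image[OF assms(1)] compact_continuous_image K_def by blast
  then obtain R where R: "K' \<subseteq> ball 0 R" using compact_imp_bounded bounded_subset_ballD by metis
  have out: "u \<in> outside K'" if "norm u \<ge> R" for u
    using outside_subset_convex[OF convex_ball R] that by auto
  have "open (inside K)" using Jordan_inside_outside[OF assms(1,2)] by (simp add: K_def)
  then obtain r where r: "r > 0" "ball w r \<subseteq> inside K"
    using assms(3) by (auto simp: K_def open_contains_ball)
  define u where "u = complex_of_real (max R (2 / r))"
  \<comment> \<open>The bound \<open>R\<close> puts \<open>u\<close> outside the image curve, and
    \<open>2 / r\<close> puts \<open>h u\<close> within distance \<open>r / 2\<close> of
    \<open>w\<close>, hence inside the original curve.\<close>
  have "max R (2 / r) > 0" using r by (simp add: less_max_iff_disj)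
  then have nu: "norm u \<ge> R" "norm u \<ge> 2 / r" "norm u > 0" unfolding u_def norm_of_real by linarith+
  then have "inverse (norm u) \<le> r / 2" using r by (simp add: field_simps)
  then have hu: "h u \<in> inside K" using r by (intro subsetD[OF r(2)]) (auto simp: h_def dist_norm norm_inverse)
  have con: "connected (outside K' - {0})" using connected_open_delete[OF J] by simp
  have "continuous_on (outside K' - {0}) h" unfolding h_def by (intro continuous_intros) auto
  then have "connected (h ` (outside K' - {0}))" using con connected_continuous_image by blast
  moreover have "h ` (outside K' - {0}) \<inter> K = {}"
  proof (clarsimp simp: disjoint_iff)
    fix v assume v: "v \<in> outside K'" "v \<noteq> 0" "h v \<in> K"
    then have "f (h v) \<in> K'" by (simp add: K'_def)
    then have "v \<in> K'" using v by (simp add: f_def h_def)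
    then show False using v outside_no_overlap by blast
  qed
  ultimately have "h ` (outside K' - {0}) \<subseteq> inside K \<or> h ` (outside K' - {0}) \<subseteq> outside K"
    by (rule connected_disjoint_inside_or_outside)
  moreover have "h u \<in> h ` (outside K' - {0})" using out[OF nu(1)] nu(3) by auto
  moreover have "z \<in> h ` (outside K' - {0})" using fz fzo by (metis Diff_iff image_eqI singletonD)
  ultimately show False using hu assms(4) inside_Int_outside[of K] unfolding K_def by blast
qed

section \<open>The edge bound for plane graphs\<close>

definition boundary :: "('a set \<Rightarrow> real \<Rightarrow> complex) \<Rightarrow> 'a list \<Rightarrow> complex set" where
  "boundary \<gamma> C = drawn \<gamma> (pedges (C @ [hd C]))"

definition in_disc ::
    "'a set \<Rightarrow> 'a set set \<Rightarrow> ('a \<Rightarrow> complex) \<Rightarrow> ('a set \<Rightarrow> real \<Rightarrow> complex) \<Rightarrow> 'a list \<Rightarrow> bool" where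
  "in_disc V E pos \<gamma> C \<longleftrightarrow>
     pos ` V \<subseteq> boundary \<gamma> C \<union> inside (boundary \<gamma> C) \<and>
     (\<forall>e \<in> E. path_image (\<gamma> e) \<subseteq> boundary \<gamma> C \<union> inside (boundary \<gamma> C))"

lemma pedges_Cons_snoc:
  assumes "p \<noteq> []"
  shows "pedges (a # p @ [b]) = insert {a, hd p} (insert {last p, b} (pedges p))"
proof -
  have "pedges (a # p @ [b]) = insert {last p, b} (pedges (a # p))"
    using assms pedges_snoc2[of "a # q" y b for q y] by (cases p rule: rev_cases) auto
  moreover have "pedges (a # p) = insert {a, hd p} (pedges p)"
    using assms by (cases p) auto
  ultimately show ?thesis by auto
qed

lemma edge_image_in_region:
  assumes "plane_graph V E pos \<gamma>" "e \<in> E" "path_image (\<gamma> e) \<subseteq> R"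
  shows "e \<subseteq> {v \<in> V. pos v \<in> R}"
  using pos_edge_subset[OF assms(1,2)] pg_edge(1)[OF assms(1,2)] assms(3) by blast

text \<open>The ear cuts the disc of \<open>C\<close> into the discs of the cycles \<open>J1\<close>
  and \<open>J2\<close>. These cover everything and share exactly the vertices and edges of the ear,
  so the two inductive bounds can be added.\<close>

lemma disc_bound_ear:
  fixes g :: nat
  assumes pg: "plane_graph V E pos \<gamma>"
    and C: "cyc E C" and disc: "in_disc V E pos \<gamma> C"
    and ab: "a \<in> set C" "b \<in> set C" "a \<noteq> b"
    and ps: "distinct (a # ps @ [b])" "set ps \<inter> set C = {}"
    and PE: "pedges (a # ps @ [b]) \<subseteq> E" "pedges (a # ps @ [b]) \<inter> pedges (C @ [hd C]) = {}"
    and IH: "\<And>V' E' C'. \<lbrakk>card E' < card E; E' \<subseteq> E; plane_graph V' E' pos \<gamma>; cyc E' C'; in_disc V' E' pos \<gamma> C'\<rbrakk>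
      \<Longrightarrow> (int g - 2) * int (card E') + int (length C') + int g \<le> int g * int (card V')"
  shows "(int g - 2) * int (card E) + int (length C) + int g \<le> int g * int (card V)"
proof -
  obtain xs ys where s: "distinct (a # xs @ b # ys)" "set C = set (a # xs @ b # ys)"
    "length C = 2 + length xs + length ys"
    "pedges (C @ [hd C]) = pedges (a # xs @ [b]) \<union> pedges (a # rev ys @ [b])"
    "pedges (a # xs @ [b]) \<inter> pedges (a # rev ys @ [b]) = {}" "xs \<noteq> [] \<or> ys \<noteq> []"
    using cyc_split[OF C ab] .
  define zs where "zs = rev ys"
  define X where "X = pedges (a # xs @ [b])"
  define Y where "Y = pedges (a # zs @ [b])"
  define P where "P = pedges (a # ps @ [b])"
  define K where "K = drawn \<gamma> (X \<union> Y)"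
  define K1 where "K1 = drawn \<gamma> (X \<union> P)"
  define K2 where "K2 = drawn \<gamma> (Y \<union> P)"
  have K: "boundary \<gamma> C = K" using s(4) by (simp add: boundary_def K_def X_def Y_def zs_def)
  have XYE: "X \<subseteq> E" "Y \<subseteq> E" using C s(4) by (auto simp: cyc_def X_def Y_def zs_def)
  have PE': "P \<subseteq> E" using PE(1) by (simp add: P_def)
  have dis: "X \<inter> Y = {}" "X \<inter> P = {}" "Y \<inter> P = {}"
    using s(4,5) PE(2) by (auto simp: X_def Y_def P_def zs_def)
  have dist: "distinct (a # xs @ b # zs)" "distinct (a # xs @ b # ps)" "distinct (a # zs @ b # ps)"
    using s(1,2) ps by (auto simp: zs_def)
  have ne1: "xs \<noteq> [] \<or> ps \<noteq> []" using dis(2) by (auto simp: X_def P_def)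
  have ne2: "zs \<noteq> [] \<or> ps \<noteq> []" using dis(3) by (auto simp: Y_def P_def)
  define J1 where "J1 = a # xs @ b # rev ps"
  define J2 where "J2 = a # zs @ b # rev ps"
  have J1: "cyc (X \<union> P) J1" "pedges (J1 @ [hd J1]) = X \<union> P"
    using cyc_join[of a xs b "rev ps" "X \<union> P"] dist ne1 by (auto simp: J1_def X_def P_def)
  have J2: "cyc (Y \<union> P) J2" "pedges (J2 @ [hd J2]) = Y \<union> P"
    using cyc_join[of a zs b "rev ps" "Y \<union> P"] dist ne2 by (auto simp: J2_def Y_def P_def)
  have discE: "path_image (\<gamma> e) \<subseteq> K \<union> inside K" if "e \<in> E" for e
    using disc that by (auto simp: in_disc_def K)
  have intE: "path_image (\<gamma> e) - pos ` e \<subseteq> inside K" if "e \<in> E" "e \<notin> X \<union> Y" for e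
  proof -
    have "(path_image (\<gamma> e) - pos ` e) \<inter> K = {}"
      using edge_interior_disjoint[OF pg that(1) _ that(2)] XYE by (simp add: K_def)
    then show ?thesis using discE[OF that(1)] by blast
  qed
  \<comment> \<open>Any ear edge is off the cycle, and its nonempty interior lies in the disc but
    misses the boundary.\<close>
  have ins: "drawn \<gamma> P \<inter> inside K \<noteq> {}"
  proof -
    have "P \<noteq> {}" by (cases ps) (auto simp: P_def)
    then obtain e where e: "e \<in> P" by auto
    then have eE: "e \<in> E" and "e \<notin> X \<union> Y" using PE' dis by auto
    then have "path_image (\<gamma> e) - pos ` e \<subseteq> inside K" using intE by simp
    moreover obtain z where "z \<in> path_image (\<gamma> e) - pos ` e" using edge_interior(2)[OF pg eE] by auto
    moreover from this have "z \<in> drawn \<gamma> P" using e by (auto simp: drawn_def)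
    ultimately show ?thesis by auto
  qed
  note theta = theta_inside[OF pg dist, folded X_def Y_def P_def, OF XYE PE' dis ins[unfolded K_def]]
  have T: "inside K1 \<inter> inside K2 = {}"
    "inside K1 \<union> inside K2 \<union> (drawn \<gamma> P - {pos a, pos b}) = inside K"
    unfolding K_def K1_def K2_def by (fact theta(1), fact theta(2))
  have UX: "\<Union> X = insert a (insert b (set xs))" and UY: "\<Union> Y = insert a (insert b (set zs))"
    and UP: "\<Union> P = insert a (insert b (set ps))"
    unfolding X_def Y_def P_def
    using Union_pedges[of "a # xs @ [b]"] Union_pedges[of "a # zs @ [b]"] Union_pedges[of "a # ps @ [b]"] by auto
  have abV: "a \<in> V" "b \<in> V" using UX XYE pg_edge(1)[OF pg] by blast+
  have posP: "pos a \<in> drawn \<gamma> P" "pos b \<in> drawn \<gamma> P"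
    using pos_in_drawn[OF pg PE'] abV UP by auto
  have XY: "drawn \<gamma> X \<inter> drawn \<gamma> Y \<subseteq> drawn \<gamma> P"
    using two_paths_curve[OF pg dist(1)] XYE dis(1) posP unfolding X_def Y_def by auto
  \<comment> \<open>Both smaller insides lie in \<open>inside K\<close>, which misses the curves of
    \<open>X\<close> and \<open>Y\<close>, and they are disjoint; \<open>X\<close> and
    \<open>Y\<close> meet only in the ends of the ear.\<close>
  have R: "(K1 \<union> inside K1) \<inter> (K2 \<union> inside K2) \<subseteq> drawn \<gamma> P"
  proof -
    have "K1 = drawn \<gamma> X \<union> drawn \<gamma> P" "K2 = drawn \<gamma> Y \<union> drawn \<gamma> P" "K = drawn \<gamma> X \<union> drawn \<gamma> Y"
      by (simp_all add: K_def K1_def K2_def drawn_Un)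
    moreover have "inside K \<inter> K = {}" by simp
    ultimately show ?thesis using T XY by blast
  qed
  have cover: "K \<union> inside K \<subseteq> (K1 \<union> inside K1) \<union> (K2 \<union> inside K2)"
    using T(2) unfolding K_def K1_def K2_def drawn_Un by blast
  define V1 where "V1 = {v \<in> V. pos v \<in> K1 \<union> inside K1}"
  define V2 where "V2 = {v \<in> V. pos v \<in> K2 \<union> inside K2}"
  define E1 where "E1 = {e \<in> E. path_image (\<gamma> e) \<subseteq> K1 \<union> inside K1}"
  define E2 where "E2 = {e \<in> E. path_image (\<gamma> e) \<subseteq> K2 \<union> inside K2}"
  have pg1: "plane_graph V1 E1 pos \<gamma>"
    by (rule plane_graph_subset[OF pg])
      (auto simp: V1_def E1_def dest: edge_image_in_region[OF pg])
  have pg2: "plane_graph V2 E2 pos \<gamma>"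
    by (rule plane_graph_subset[OF pg])
      (auto simp: V2_def E2_def dest: edge_image_in_region[OF pg])
  have XP1: "X \<union> P \<subseteq> E1" using XYE PE' by (auto simp: E1_def K1_def drawn_def)
  have YP2: "Y \<union> P \<subseteq> E2" using XYE PE' by (auto simp: E2_def K2_def drawn_def)
  have d1: "in_disc V1 E1 pos \<gamma> J1"
    unfolding in_disc_def boundary_def J1(2) K1_def[symmetric] by (auto simp: V1_def E1_def)
  have d2: "in_disc V2 E2 pos \<gamma> J2"
    unfolding in_disc_def boundary_def J2(2) K2_def[symmetric] by (auto simp: V2_def E2_def)
  have VU: "V1 \<union> V2 = V"
    using disc cover unfolding in_disc_def K V1_def V2_def by blast
  have VI: "V1 \<inter> V2 = set (a # ps @ [b])"
  proof
    show "V1 \<inter> V2 \<subseteq> set (a # ps @ [b])"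
    proof
      fix v assume v: "v \<in> V1 \<inter> V2"
      then have "pos v \<in> drawn \<gamma> P" "v \<in> V" using R by (auto simp: V1_def V2_def)
      then show "v \<in> set (a # ps @ [b])" using pos_in_drawn[OF pg PE'] UP by auto
    qed
    show "set (a # ps @ [b]) \<subseteq> V1 \<inter> V2"
    proof
      fix v assume "v \<in> set (a # ps @ [b])"
      then have v: "v \<in> \<Union> P" using UP by auto
      then have "v \<in> V" using PE' pg_edge(1)[OF pg] by blast
      moreover have "pos v \<in> drawn \<gamma> P" using pos_in_drawn[OF pg PE' \<open>v \<in> V\<close>] v by simp
      ultimately show "v \<in> V1 \<inter> V2" by (auto simp: V1_def V2_def K1_def K2_def drawn_Un)
    qed
  qed
  \<comment> \<open>The interior of an edge off the three paths lies in \<open>inside K\<close> and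
    misses the ear, so it meets \<open>inside K1\<close> or \<open>inside K2\<close>. As it cannot
    change sides of a cycle, the edge belongs to that disc.\<close>
  have EU: "E1 \<union> E2 = E"
  proof
    show "E \<subseteq> E1 \<union> E2"
    proof
      fix e assume e: "e \<in> E"
      show "e \<in> E1 \<union> E2"
      proof (cases "e \<in> X \<union> Y \<union> P")
        case True
        then show ?thesis using XP1 YP2 by blast
      next
        case False
        let ?I = "path_image (\<gamma> e) - pos ` e"
        have I: "?I \<noteq> {}" "?I \<subseteq> inside K" "?I \<inter> drawn \<gamma> P = {}"
          using edge_interior(2)[OF pg e] intE[OF e] edge_interior_disjoint[OF pg e PE'] False by auto
        have "X \<union> P \<subseteq> E" "Y \<union> P \<subseteq> E" using XYE PE' by auto
        then have "path_image (\<gamma> e) \<subseteq> K1 \<union> inside K1 \<or> ?I \<subseteq> outside K1"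
          "path_image (\<gamma> e) \<subseteq> K2 \<union> inside K2 \<or> ?I \<subseteq> outside K2"
          using edge_inside_or_outside[OF pg e] False unfolding K1_def K2_def by blast+
        moreover have "\<not> (?I \<subseteq> outside K1 \<and> ?I \<subseteq> outside K2)"
          using I T(2) inside_Int_outside[of K1] inside_Int_outside[of K2] by blast
        ultimately show ?thesis using e by (auto simp: E1_def E2_def)
      qed
    qed
  qed (auto simp: E1_def E2_def)
  have EI: "E1 \<inter> E2 = P"
  proof
    show "E1 \<inter> E2 \<subseteq> P"
    proof
      fix e assume e: "e \<in> E1 \<inter> E2"
      then have eE: "e \<in> E" by (auto simp: E1_def)
      have "path_image (\<gamma> e) \<subseteq> drawn \<gamma> P" using e R unfolding E1_def E2_def by blast
      then show "e \<in> P"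
        using edge_interior(2)[OF pg eE] edge_interior_disjoint[OF pg eE PE'] by blast
    qed
  qed (use XP1 YP2 in auto)
  have finE: "finite E" and finV: "finite V" using pg_finE[OF pg] pg_finV[OF pg] .
  have f: "finite V1" "finite V2" "finite E1" "finite E2"
    using finE finV VU EU by (metis finite_Un)+
  have cV: "card V1 + card V2 = card V + (length ps + 2)"
    using card_Un_Int[OF f(1,2)] VU VI distinct_card[OF ps(1)] by simp
  have cE: "card E1 + card E2 = card E + (length ps + 1)"
    using card_Un_Int[OF f(3,4)] EU EI card_pedges[OF ps(1)] by (simp add: P_def)
  \<comment> \<open>Each of the two cycles has more edges than the ear, which is all that
    \<open>E1\<close> and \<open>E2\<close> have in common; hence both are smaller than
    \<open>E\<close>.\<close>
  have "length J1 \<le> card E1" "length J2 \<le> card E2"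
    using card_pedges_closed[of J1] card_pedges_closed[of J2] J1 J2 XP1 YP2 f card_mono[of E1 "X \<union> P"]
      card_mono[of E2 "Y \<union> P"] by (auto simp: cyc_def)
  then have lt: "card E1 < card E" "card E2 < card E"
    using cE by (auto simp: J1_def J2_def)
  have b1: "(int g - 2) * int (card E1) + int (length J1) + int g \<le> int g * int (card V1)"
    using IH[OF lt(1) _ pg1 cyc_mono[OF J1(1) XP1] d1] EU by auto
  have b2: "(int g - 2) * int (card E2) + int (length J2) + int g \<le> int g * int (card V2)"
    using IH[OF lt(2) _ pg2 cyc_mono[OF J2(1) YP2] d2] EU by auto
  have "int g * int (card V1 + card V2) = int g * int (card V + (length ps + 2))"
    "(int g - 2) * int (card E1 + card E2) = (int g - 2) * int (card E + (length ps + 1))"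
    using cV cE by simp_all
  moreover have "int (length J1) = 2 + int (length xs) + int (length ps)"
    "int (length J2) = 2 + int (length ys) + int (length ps)"
    "int (length C) = 2 + int (length xs) + int (length ys)"
    using s(3) by (simp_all add: J1_def J2_def zs_def)
  ultimately show ?thesis using b1 b2 by (simp add: algebra_simps)
qed

text \<open>The edges at \<open>U\<close> span a plane graph on at most \<open>card U + 1\<close>
  vertices. The constant \<open>g\<close> in the general bound absorbs the attaching vertex, so
  these edges weigh at most \<open>g * card U\<close>, and the disc bound for the rest can be added
  without loss.\<close>

lemma disc_bound_pendant:
  fixes g :: nat
  assumes pg: "plane_graph V E pos \<gamma>"
    and C: "cyc E C" and disc: "in_disc V E pos \<gamma> C"
    and U: "U \<subseteq> V" "U \<inter> set C = {}" "U \<noteq> {}"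
    and A: "A \<subseteq> set C" "card A \<le> 1"
    and UA: "\<And>e. e \<in> E \<Longrightarrow> e \<inter> U \<noteq> {} \<Longrightarrow> e \<subseteq> U \<union> A"
    and ex: "e \<in> E" "e \<inter> U \<noteq> {}"
    and IHA: "\<And>V' E'. \<lbrakk>card E' < card E; E' \<subseteq> E; plane_graph V' E' pos \<gamma>; V' \<noteq> {}\<rbrakk>
      \<Longrightarrow> (int g - 2) * int (card E') + int g \<le> int g * int (card V')"
    and IHB: "\<And>V' E' C'. \<lbrakk>card E' < card E; E' \<subseteq> E; plane_graph V' E' pos \<gamma>; cyc E' C'; in_disc V' E' pos \<gamma> C'\<rbrakk>
      \<Longrightarrow> (int g - 2) * int (card E') + int (length C') + int g \<le> int g * int (card V')"
  shows "(int g - 2) * int (card E) + int (length C) + int g \<le> int g * int (card V)"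
proof -
  have finE: "finite E" and finV: "finite V" using pg_finE[OF pg] pg_finV[OF pg] .
  define E1 where "E1 = {e \<in> E. e \<inter> U \<noteq> {}}"
  have D: "pedges (C @ [hd C]) \<subseteq> E - E1"
  proof
    fix d assume d: "d \<in> pedges (C @ [hd C])"
    have "d \<subseteq> set C" using pedges_subset[OF d] C by (cases C) (auto simp: cyc_def)
    moreover have "d \<in> E" using d C by (auto simp: cyc_def)
    ultimately show "d \<in> E - E1" using U(2) by (auto simp: E1_def)
  qed
  have CV: "set C \<subseteq> V"
  proof -
    have "set C = \<Union> (pedges (C @ [hd C]))"
      using Union_pedges[of "C @ [hd C]"] C by (cases C) (auto simp: cyc_def)
    also have "\<dots> \<subseteq> V" using D pg_edge(1)[OF pg] by blast
    finally show ?thesis .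
  qed
  have "0 < card (pedges (C @ [hd C]))" using card_pedges_closed[of C] C by (auto simp: cyc_def)
  then have "pedges (C @ [hd C]) \<noteq> {}" by auto
  then have "E - E1 \<noteq> {}" using D by blast
  then have lt1: "card E1 < card E" using finE by (intro psubset_card_mono) (auto simp: E1_def)
  have lt2: "card (E - E1) < card E"
    using finE ex by (intro psubset_card_mono) (auto simp: E1_def)
  have "plane_graph (U \<union> A) E1 pos \<gamma>"
    using U A CV UA by (intro plane_graph_subset[OF pg]) (auto simp: E1_def)
  then have b1: "(int g - 2) * int (card E1) + int g \<le> int g * int (card (U \<union> A))"
    using IHA[OF lt1] U(3) by (auto simp: E1_def)
  have "plane_graph (V - U) (E - E1) pos \<gamma>"
    by (rule plane_graph_subset[OF pg]) (use pg_edge(1)[OF pg] in \<open>auto simp: E1_def\<close>)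
  moreover have "cyc (E - E1) C" using C D by (auto simp: cyc_def)
  moreover have "in_disc (V - U) (E - E1) pos \<gamma> C" using disc by (auto simp: in_disc_def)
  ultimately have b2: "(int g - 2) * int (card (E - E1)) + int (length C) + int g \<le> int g * int (card (V - U))"
    using IHB[OF lt2] by auto
  have "card (U \<union> A) \<le> card U + 1" using card_Un_le[of U A] A by linarith
  then have "int g * int (card (U \<union> A)) \<le> int g * (int (card U) + 1)" by (intro mult_left_mono) auto
  moreover have "int (card E) = int (card E1) + int (card (E - E1))"
    using finE card_Un_disjoint[of E1 "E - E1"] by (simp add: E1_def Un_absorb1 finite_subset subset_iff)
  moreover have "int (card V) = int (card U) + int (card (V - U))"
    using finV U(1) by (simp add: card_Diff_subset card_mono finite_subset of_nat_diff)
  ultimately show ?thesis using b1 b2 by (simp add: algebra_simps)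
qed

text \<open>If \<open>e\<close> is not a chord, it has an end \<open>u\<close> off the cycle. Let
  \<open>U\<close> be the component of \<open>u\<close> after deletion of the cycle and
  \<open>A\<close> the set of cycle vertices adjacent to it. Two vertices of \<open>A\<close> are
  joined by an ear through \<open>U\<close>; otherwise \<open>U\<close> hangs on at most one
  vertex.\<close>

lemma ear_or_pendant:
  assumes pg: "plane_graph V E pos \<gamma>" and C: "cyc E C" and e: "e \<in> E" "e \<notin> pedges (C @ [hd C])"
  shows "(\<exists>a b ps. a \<in> set C \<and> b \<in> set C \<and> a \<noteq> b \<and> distinct (a # ps @ [b]) \<and> set ps \<inter> set C = {} \<and>
            pedges (a # ps @ [b]) \<subseteq> E \<and> pedges (a # ps @ [b]) \<inter> pedges (C @ [hd C]) = {}) \<or>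
         (\<exists>U A. U \<subseteq> V \<and> U \<inter> set C = {} \<and> A \<subseteq> set C \<and> card A \<le> 1 \<and>
            (\<forall>e \<in> E. e \<inter> U \<noteq> {} \<longrightarrow> e \<subseteq> U \<union> A) \<and> e \<inter> U \<noteq> {})"
    (is "?ear \<or> ?pend")
proof -
  have DC: "d \<subseteq> set C" if "d \<in> pedges (C @ [hd C])" for d
    using pedges_subset[OF that] C by (cases C) (auto simp: cyc_def)
  show ?thesis
  proof (cases "e \<subseteq> set C")
    case True
    obtain u w where uw: "e = {u, w}" "u \<noteq> w" using pg_edge(2)[OF pg e(1)] by (auto simp: card_2_iff)
    have ?ear by (rule exI[of _ u], rule exI[of _ w], rule exI[of _ "[]"]) (use uw True e in auto)
    then show ?thesis by simp
  next
    case False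
    then obtain u where u: "u \<in> e" "u \<notin> set C" by auto
    define R where "R = {(x, y). {x, y} \<in> E \<and> x \<notin> set C \<and> y \<notin> set C}"
    define U where "U = R\<^sup>* `` {u}"
    have uV: "u \<in> V" using u e pg_edge(1)[OF pg] by blast
    have U: "U \<subseteq> V" "U \<inter> set C = {}"
    proof -
      have "y \<in> V - set C" if "(u, y) \<in> R\<^sup>*" for y
        using that
      proof (induction rule: rtrancl_induct)
        case (step y z)
        then show ?case using pg_edge(1)[OF pg] unfolding R_def by blast
      qed (use uV u in auto)
      then show "U \<subseteq> V" "U \<inter> set C = {}" by (auto simp: U_def)
    qed
    have "sym R" by (auto simp: R_def sym_def insert_commute)
    then have sym: "sym (R\<^sup>*)" by (rule sym_rtrancl)
    define A where "A = {a \<in> set C. \<exists>s \<in> U. {s, a} \<in> E}"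
    have closed: "d \<subseteq> U \<union> A" if dU: "d \<in> E" "d \<inter> U \<noteq> {}" for d
    proof
      fix y assume y: "y \<in> d"
      obtain s where s: "s \<in> d" "s \<in> U" using dU by auto
      show "y \<in> U \<union> A"
      proof (cases "y = s")
        case False
        then have d: "d = {s, y}" using pg_edge(2)[OF pg that(1)] s y by (auto simp: card_2_iff)
        show ?thesis
        proof (cases "y \<in> set C")
          case True
          then show ?thesis using d s that by (auto simp: A_def)
        next
          case False
          then have "(s, y) \<in> R" using d that s U(2) by (auto simp: R_def)
          then show ?thesis using s by (auto simp: U_def intro: rtrancl_into_rtrancl)
        qed
      qed (use s in simp)
    qed
    have uU: "u \<in> U" by (simp add: U_def)
    show ?thesis
    proof (cases "card A \<le> 1")
      case True
      have "A \<subseteq> set C" by (auto simp: A_def)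
      moreover have "\<forall>d \<in> E. d \<inter> U \<noteq> {} \<longrightarrow> d \<subseteq> U \<union> A" using closed by simp
      moreover have "e \<inter> U \<noteq> {}" using u uU by blast
      ultimately have ?pend
        using True U by (intro exI[of _ U] exI[of _ A] conjI)
      then show ?thesis by simp
    next
      case False
      then have "\<not> is_singleton A \<and> A \<noteq> {}" by (auto simp: is_singleton_altdef)
      then obtain a b where ab: "a \<in> A" "b \<in> A" "a \<noteq> b"
        by (metis is_singletonI' )
      obtain s t where st: "s \<in> U" "{s, a} \<in> E" "t \<in> U" "{t, b} \<in> E"
        using ab by (auto simp: A_def)
      have abC: "a \<in> set C" "b \<in> set C" using ab by (auto simp: A_def)
      have "(s, u) \<in> R\<^sup>*" "(u, t) \<in> R\<^sup>*" using st sym by (auto simp: U_def dest: symD)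
      then have "(s, t) \<in> R\<^sup>*" by (rule rtrancl_trans)
      moreover have "s \<notin> set C" using st U(2) by blast
      ultimately obtain p where p: "p \<noteq> []" "hd p = s" "last p = t" "distinct p" "pedges p \<subseteq> E"
        "set p \<inter> set C = {}"
        using reachable_distinct_path[of s t E "set C"] unfolding R_def by blast
      have pe: "pedges (a # p @ [b]) = insert {a, s} (insert {t, b} (pedges p))"
        using pedges_Cons_snoc[OF p(1)] p(2,3) by simp
      have "d \<notin> pedges (C @ [hd C])" if "d \<in> pedges (a # p @ [b])" for d
      proof
        assume "d \<in> pedges (C @ [hd C])"
        then have dC: "d \<subseteq> set C" by (rule DC)
        have "s \<in> set p" "t \<in> set p" using p(1-3) by auto
        then have "d \<in> pedges p" using that dC p(6) unfolding pe by auto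
        then have "d \<subseteq> set p" "d \<in> E" using pedges_subset p(5) by auto
        moreover have "d \<noteq> {}" using pg_edge(2)[OF pg \<open>d \<in> E\<close>] by auto
        ultimately show False using dC p(6) by auto
      qed
      moreover have "pedges (a # p @ [b]) \<subseteq> E" using pe p(5) st by (simp add: insert_commute)
      moreover have "distinct (a # p @ [b])" using p abC ab(3) by auto
      ultimately have ?ear
        by (intro exI[of _ a] exI[of _ b] exI[of _ p]) (use p abC ab in auto)
      then show ?thesis by simp
    qed
  qed
qed

lemma disc_bound_step:
  fixes g :: nat
  assumes pg: "plane_graph V E pos \<gamma>"
    and girth: "\<And>p. cyc E p \<Longrightarrow> g \<le> length p"
    and C: "cyc E C" and disc: "in_disc V E pos \<gamma> C"
    and IHA: "\<And>V' E'. \<lbrakk>card E' < card E; E' \<subseteq> E; plane_graph V' E' pos \<gamma>; V' \<noteq> {}\<rbrakk>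
      \<Longrightarrow> (int g - 2) * int (card E') + int g \<le> int g * int (card V')"
    and IHB: "\<And>V' E' C'. \<lbrakk>card E' < card E; E' \<subseteq> E; plane_graph V' E' pos \<gamma>; cyc E' C'; in_disc V' E' pos \<gamma> C'\<rbrakk>
      \<Longrightarrow> (int g - 2) * int (card E') + int (length C') + int g \<le> int g * int (card V')"
  shows "(int g - 2) * int (card E) + int (length C) + int g \<le> int g * int (card V)"
proof (cases "E \<subseteq> pedges (C @ [hd C])")
  case True
  then have E: "E = pedges (C @ [hd C])" using C by (auto simp: cyc_def)
  have d: "3 \<le> length C" "distinct C" using C by (auto simp: cyc_def)
  have "set C = \<Union> E" unfolding E using Union_pedges[of "C @ [hd C]"] d by (cases C) auto
  then have "set C \<subseteq> V" using pg_edge(1)[OF pg] by blast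
  then have "length C \<le> card V" using card_mono[OF pg_finV[OF pg]] distinct_card[OF d(2)] by metis
  then have "int g * int (length C) \<le> int g * int (card V)" by (intro mult_left_mono) auto
  moreover have "card E = length C" using card_pedges_closed[OF d] E by simp
  \<comment> \<open>For a bare cycle the number of edges is \<open>length C\<close> and there are at
    least as many vertices, so the bound comes down to \<open>g \<le> length C\<close>. This is
    where the girth acts.\<close>
  moreover have "int g \<le> int (length C)" using girth[OF C] by simp
  ultimately show ?thesis by (simp add: algebra_simps)
next
  case False
  then obtain e where e: "e \<in> E" "e \<notin> pedges (C @ [hd C])" by auto
  show ?thesis
    using ear_or_pendant[OF pg C e]
  proof (elim disjE exE conjE)
    fix a b ps
    assume ear: "a \<in> set C" "b \<in> set C" "a \<noteq> b" "distinct (a # ps @ [b])" "set ps \<inter> set C = {}"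
      "pedges (a # ps @ [b]) \<subseteq> E" "pedges (a # ps @ [b]) \<inter> pedges (C @ [hd C]) = {}"
    show ?thesis by (rule disc_bound_ear[OF pg C disc ear IHB])
  next
    fix U A
    assume U: "U \<subseteq> V" "U \<inter> set C = {}" "A \<subseteq> set C" "card A \<le> 1"
      "\<forall>e \<in> E. e \<inter> U \<noteq> {} \<longrightarrow> e \<subseteq> U \<union> A" "e \<inter> U \<noteq> {}"
    have ne: "U \<noteq> {}" and cl: "\<And>e. e \<in> E \<Longrightarrow> e \<inter> U \<noteq> {} \<Longrightarrow> e \<subseteq> U \<union> A"
      using U(5,6) by auto
    show ?thesis by (rule disc_bound_pendant[OF pg C disc U(1,2) ne U(3,4) cl e(1) U(6) IHA IHB])
  qed
qed

text \<open>Hypothesis \<open>B\<close> ranges over all drawings, since the part outside the chosen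
  cycle is redrawn by an inversion. It allows \<open>card E' = card E\<close>, since all edges may
  lie on one side of the cycle.\<close>

lemma plane_bound_step:
  fixes g :: nat
  assumes pg: "plane_graph V E pos \<gamma>" and "V \<noteq> {}" and "3 \<le> g"
    and B: "\<And>V' E' C' pos' \<gamma>'. \<lbrakk>card E' \<le> card E; E' \<subseteq> E; plane_graph V' E' pos' \<gamma>'; cyc E' C'; in_disc V' E' pos' \<gamma>' C'\<rbrakk>
      \<Longrightarrow> (int g - 2) * int (card E') + int (length C') + int g \<le> int g * int (card V')"
  shows "(int g - 2) * int (card E) + int g \<le> int g * int (card V)"
proof (cases "\<exists>C. cyc E C")
  case False
  then have "card E < card V"
    using acyclic_card_edges[OF pg_finV[OF pg]] pg_edge[OF pg] assms(2) by blast
  \<comment> \<open>The remaining difference to the claim is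
    \<open>2 \<le> 2 * card V\<close>.\<close>
  then have "(int g - 2) * (int (card E) + 1) \<le> (int g - 2) * int (card V)"
    using assms(3) by (intro mult_left_mono) auto
  moreover have "2 * int (card V) \<ge> 2" using \<open>card E < card V\<close> by linarith
  ultimately show ?thesis by (simp add: algebra_simps)
next
  case True
  then obtain C where C: "cyc E C" by auto
  define D where "D = pedges (C @ [hd C])"
  define K where "K = drawn \<gamma> D"
  have d: "3 \<le> length C" "distinct C" and DE: "D \<subseteq> E" using C by (auto simp: cyc_def D_def)
  have UD: "set C = \<Union> D" unfolding D_def using Union_pedges[of "C @ [hd C]"] d by (cases C) auto
  have cycD: "cyc E' C" if "D \<subseteq> E'" for E' using that d by (auto simp: cyc_def D_def)
  obtain c where c: "simple_path c" "pathfinish c = pathstart c" "path_image c = K"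
    using cycle_curve[OF pg C] by (auto simp: K_def D_def)
  define V1 where "V1 = {v \<in> V. pos v \<in> K \<union> inside K}"
  define V2 where "V2 = {v \<in> V. pos v \<in> K \<union> outside K}"
  define E1 where "E1 = {e \<in> E. path_image (\<gamma> e) \<subseteq> K \<union> inside K}"
  define E2 where "E2 = {e \<in> E. path_image (\<gamma> e) \<subseteq> K \<union> outside K}"
  have pg1: "plane_graph V1 E1 pos \<gamma>"
    by (rule plane_graph_subset[OF pg])
      (auto simp: V1_def E1_def dest: edge_image_in_region[OF pg])
  have pg2: "plane_graph V2 E2 pos \<gamma>"
    by (rule plane_graph_subset[OF pg])
      (auto simp: V2_def E2_def dest: edge_image_in_region[OF pg])
  have D12: "D \<subseteq> E1" "D \<subseteq> E2" using DE by (auto simp: E1_def E2_def K_def drawn_def)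
  have finE: "finite E" and finV: "finite V" using pg_finE[OF pg] pg_finV[OF pg] .
  have EU: "E1 \<union> E2 = E"
  proof
    show "E \<subseteq> E1 \<union> E2"
    proof
      fix e assume e: "e \<in> E"
      show "e \<in> E1 \<union> E2"
      proof (cases "e \<in> D")
        case False
        then show ?thesis
          using edge_inside_or_outside[OF pg e DE False] e by (auto simp: E1_def E2_def K_def)
      qed (use D12 in auto)
    qed
  qed (auto simp: E1_def E2_def)
  have io: "(K \<union> inside K) \<inter> (K \<union> outside K) = K" using inside_Int_outside[of K] by blast
  have EI: "E1 \<inter> E2 = D"
  proof
    show "E1 \<inter> E2 \<subseteq> D"
    proof
      fix e assume e: "e \<in> E1 \<inter> E2"
      then have eE: "e \<in> E" by (auto simp: E1_def)
      have "path_image (\<gamma> e) \<subseteq> K" using e io unfolding E1_def E2_def by blast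
      then show "e \<in> D"
        using edge_interior(2)[OF pg eE] edge_interior_disjoint[OF pg eE DE] by (auto simp: K_def)
    qed
  qed (use D12 in auto)
  have "z \<in> K \<or> z \<in> inside K \<or> z \<in> outside K" for z using inside_Un_outside[of K] by blast
  then have VU: "V1 \<union> V2 = V" by (auto simp: V1_def V2_def)
  have "V1 \<inter> V2 = {v \<in> V. pos v \<in> (K \<union> inside K) \<inter> (K \<union> outside K)}" by (auto simp: V1_def V2_def)
  also have "\<dots> = {v \<in> V. v \<in> \<Union> D}" unfolding io using pos_in_drawn[OF pg DE] by (auto simp: K_def)
  also have "\<dots> = set C" using UD DE pg_edge(1)[OF pg] by blast
  finally have VI: "V1 \<inter> V2 = set C" .
  have f: "finite V1" "finite V2" "finite E1" "finite E2"
    using finE finV VU EU by (metis finite_Un)+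
  have cV: "card V1 + card V2 = card V + length C"
    using card_Un_Int[OF f(1,2)] VU VI distinct_card[OF d(2)] by simp
  have cE: "card E1 + card E2 = card E + length C"
    using card_Un_Int[OF f(3,4)] EU EI card_pedges_closed[OF d] by (simp add: D_def)
  have sub: "E1 \<subseteq> E" "E2 \<subseteq> E" "card E1 \<le> card E" "card E2 \<le> card E"
    using EU finE by (auto intro: card_mono)
  have "in_disc V1 E1 pos \<gamma> C"
    unfolding in_disc_def boundary_def D_def[symmetric] K_def[symmetric] by (auto simp: V1_def E1_def)
  then have b1: "(int g - 2) * int (card E1) + int (length C) + int g \<le> int g * int (card V1)"
    using B[OF sub(3,1) pg1 cycD[OF D12(1)]] by blast
  \<comment> \<open>Such a \<open>w\<close> is off the part drawn on or outside the cycle, so that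
    part can be inverted about \<open>w\<close>.\<close>
  obtain w where w: "w \<in> inside K" using Jordan_inside_outside[OF c(1,2)] c(3) by auto
  define f where "f = (\<lambda>z. inverse (z - w))"
  have "w \<notin> K \<union> outside K" using w inside_no_overlap[of K] inside_Int_outside[of K] by blast
  then have "w \<notin> pos ` V2" "w \<notin> drawn \<gamma> E2" by (auto simp: V2_def E2_def drawn_def)
  then have pg2': "plane_graph V2 E2 (f \<circ> pos) (\<lambda>e. f \<circ> \<gamma> e)"
    using plane_graph_inversion[OF pg2] by (simp add: f_def)
  have out: "f ` (K \<union> outside K) \<subseteq> f ` K \<union> inside (f ` K)"
    using inversion_outside[OF c(1,2)] w c(3) by (auto simp: f_def)
  have bd: "boundary (\<lambda>e. f \<circ> \<gamma> e) C = f ` K"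
    by (auto simp: boundary_def drawn_def path_image_compose K_def D_def)
  have "in_disc V2 E2 (f \<circ> pos) (\<lambda>e. f \<circ> \<gamma> e) C"
    unfolding in_disc_def bd
  proof (intro conjI ballI)
    have "pos ` V2 \<subseteq> K \<union> outside K" by (auto simp: V2_def)
    then show "(f \<circ> pos) ` V2 \<subseteq> f ` K \<union> inside (f ` K)" using out by (auto simp: image_comp[symmetric])
    fix e assume "e \<in> E2"
    then have "path_image (\<gamma> e) \<subseteq> K \<union> outside K" by (auto simp: E2_def)
    then show "path_image (f \<circ> \<gamma> e) \<subseteq> f ` K \<union> inside (f ` K)" using out
      by (auto simp: path_image_compose)
  qed
  then have b2: "(int g - 2) * int (card E2) + int (length C) + int g \<le> int g * int (card V2)"
    using B[OF sub(4,2) pg2' cycD[OF D12(2)]] by blast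
  \<comment> \<open>Only the cycle is counted twice. Its edges and the two boundary terms contribute
    \<open>(g - 2) + 2 = g\<close> per edge, which cancels against its vertices; of the two
    constants \<open>g\<close> one is kept.\<close>
  have "int g * int (card V1 + card V2) = int g * int (card V + length C)"
    "(int g - 2) * int (card E1 + card E2) = (int g - 2) * int (card E + length C)"
    using cV cE by simp_all
  then show ?thesis using b1 b2 by (simp add: algebra_simps)
qed

text \<open>The general bound \<open>A\<close> and the disc bound \<open>B\<close> are proved
  together by induction on the number of edges: pendant parts in a disc call for \<open>A\<close> on
  fewer edges, while \<open>A\<close> calls for \<open>B\<close> on at most as many. Hence
  \<open>B n\<close> precedes \<open>A n\<close>.\<close>

theorem plane_graph_edge_bound:
  fixes g :: nat
  assumes "plane_graph V E pos \<gamma>" "V \<noteq> {}" "3 \<le> g" "\<And>p. cyc E p \<Longrightarrow> g \<le> length p"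
  shows "(int g - 2) * int (card E) + int g \<le> int g * int (card V)"
proof -
  define A where "A = (\<lambda>n. \<forall>V (E :: 'a set set) pos \<gamma>. card E = n \<longrightarrow> plane_graph V E pos \<gamma> \<longrightarrow>
    (\<forall>p. cyc E p \<longrightarrow> g \<le> length p) \<longrightarrow> V \<noteq> {} \<longrightarrow>
    (int g - 2) * int (card E) + int g \<le> int g * int (card V))"
  define B where "B = (\<lambda>n. \<forall>V (E :: 'a set set) pos \<gamma> C. card E = n \<longrightarrow> plane_graph V E pos \<gamma> \<longrightarrow>
    (\<forall>p. cyc E p \<longrightarrow> g \<le> length p) \<longrightarrow> cyc E C \<longrightarrow> in_disc V E pos \<gamma> C \<longrightarrow>
    (int g - 2) * int (card E) + int (length C) + int g \<le> int g * int (card V))"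
  have "A n \<and> B n" for n
  proof (induction n rule: less_induct)
    case (less n)
    have Bn: "B n"
      unfolding B_def
    proof (intro allI impI)
      fix V and E :: "'a set set" and pos \<gamma> C
      assume n: "card E = n" and pg: "plane_graph V E pos \<gamma>"
        and girth: "\<forall>p. cyc E p \<longrightarrow> g \<le> length p" and C: "cyc E C" "in_disc V E pos \<gamma> C"
      show "(int g - 2) * int (card E) + int (length C) + int g \<le> int g * int (card V)"
      proof (rule disc_bound_step[OF pg _ C])
        show "g \<le> length p" if "cyc E p" for p using girth that by blast
        fix V' and E' :: "'a set set"
        assume E': "card E' < card E" "E' \<subseteq> E" "plane_graph V' E' pos \<gamma>"
        have girth': "\<forall>p. cyc E' p \<longrightarrow> g \<le> length p" using girth cyc_mono E'(2) by blast
        show "(int g - 2) * int (card E') + int g \<le> int g * int (card V')" if "V' \<noteq> {}"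
          using less.IH[of "card E'"] E' n girth' that unfolding A_def by blast
        show "(int g - 2) * int (card E') + int (length C') + int g \<le> int g * int (card V')"
          if "cyc E' C'" "in_disc V' E' pos \<gamma> C'" for C'
          using less.IH[of "card E'"] E' n girth' that unfolding B_def by blast
      qed
    qed
    have "A n"
      unfolding A_def
    proof (intro allI impI)
      fix V and E :: "'a set set" and pos \<gamma>
      assume n: "card E = n" and pg: "plane_graph V E pos \<gamma>"
        and girth: "\<forall>p. cyc E p \<longrightarrow> g \<le> length p" and V: "V \<noteq> {}"
      show "(int g - 2) * int (card E) + int g \<le> int g * int (card V)"
      proof (rule plane_bound_step[OF pg V assms(3)])
        fix V' C' pos' \<gamma>' and E' :: "'a set set"
        assume E': "card E' \<le> card E" "E' \<subseteq> E" "plane_graph V' E' pos' \<gamma>'" "cyc E' C'"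
          "in_disc V' E' pos' \<gamma>' C'"
        have "B (card E')" using less.IH[of "card E'"] Bn E'(1) n by (cases "card E' = n") auto
        moreover have "\<forall>p. cyc E' p \<longrightarrow> g \<le> length p" using girth cyc_mono E'(2) by blast
        ultimately show "(int g - 2) * int (card E') + int (length C') + int g \<le> int g * int (card V')"
          using E' unfolding B_def by blast
      qed
    qed
    with Bn show ?case by simp
  qed
  then show ?thesis using assms unfolding A_def by blast
qed

section \<open>Reducible configurations\<close>

lemma card_Diff_insert_ge:
  assumes "n + 1 \<le> card A"
  shows "n \<le> card (A - {p})"
  using assms card_Diff_singleton_if[of A p] by (auto split: if_splits)

lemma card_Diff_insert2_ge:
  assumes "n + 2 \<le> card A"
  shows "n \<le> card (A - {p, q})"
proof -
  have "n \<le> card (A - {p} - {q})"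
    using assms by (intro card_Diff_insert_ge) simp
  moreover have "A - {p} - {q} = A - {p, q}" by auto
  ultimately show ?thesis by simp
qed

lemma ex_avoiding:
  assumes "2 \<le> card A"
  shows "\<exists>x\<in>A. x \<noteq> p"
  using card_Diff_insert_ge[of 1 A p] assms by (fastforce simp: card_le_Suc_iff numeral_2_eq_2)

lemma ex_avoiding2:
  assumes "3 \<le> card A"
  shows "\<exists>x\<in>A. x \<noteq> p \<and> x \<noteq> q"
proof -
  have "2 \<le> card (A - {p})" using assms by (intro card_Diff_insert_ge) simp
  then show ?thesis using ex_avoiding[of "A - {p}" q] by auto
qed

lemma ex_two:
  assumes "2 \<le> card A"
  obtains x y where "x \<in> A" "y \<in> A" "x \<noteq> y"
proof -
  obtain x where "x \<in> A" using assms by (metis card.empty ex_in_conv not_numeral_le_zero)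
  then show thesis using ex_avoiding[OF assms, of x] that by blast
qed

lemma ex1_color_pair:
  assumes "N = {a, b}" "\<psi> a \<noteq> \<psi> b"
  shows "\<exists>c. \<exists>!u. u \<in> N \<and> \<psi> u = c"
  using assms by (intro exI[of _ "\<psi> a"]) auto

text \<open>The square of a path on four vertices is a complete graph minus one edge.\<close>

lemma square_path_choosable:
  assumes "2 \<le> card A" "3 \<le> card B" "3 \<le> card C" "2 \<le> card D"
  shows "\<exists>a\<in>A. \<exists>b\<in>B. \<exists>c\<in>C. \<exists>d\<in>D. a \<noteq> b \<and> a \<noteq> c \<and> b \<noteq> c \<and> b \<noteq> d \<and> c \<noteq> d"
proof -
  have witness: ?thesis
    if "a \<in> A" "b \<in> B" "c \<in> C" "d \<in> D" "a \<noteq> b" "a \<noteq> c" "b \<noteq> c" "b \<noteq> d" "c \<noteq> d" for a b c d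
    using that by auto
  show ?thesis
  proof (cases "A \<inter> D = {}")
    case False
    then obtain t where t: "t \<in> A" "t \<in> D" by auto
    obtain b where b: "b \<in> B" "b \<noteq> t" using ex_avoiding[of B t] assms by auto
    obtain c where c: "c \<in> C" "c \<noteq> t" "c \<noteq> b" using ex_avoiding2[of C t b] assms by auto
    show ?thesis by (rule witness[OF t(1) b(1) c(1) t(2)]) (use b c in simp_all)
  next
    case True
    obtain a1 a2 where a: "a1 \<in> A" "a2 \<in> A" "a1 \<noteq> a2" using ex_two assms(1) by blast
    obtain d1 d2 where d: "d1 \<in> D" "d2 \<in> D" "d1 \<noteq> d2" using ex_two assms(4) by blast
    obtain B' where B': "B' \<subseteq> B" "card B' = 3" using obtain_subset_with_card_n[OF assms(2)] by metis
    have "a1 \<noteq> d1" "a1 \<noteq> d2" "a2 \<noteq> d1" "a2 \<noteq> d2" using a d True by blast+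
    \<comment> \<open>Four end colors do not fit into three colors of \<open>B\<close>, so some end
      color \<open>t\<close> is harmless for \<open>b\<close>. With that end colored
      \<open>t\<close>, only \<open>c\<close> and the other end still restrict
      \<open>b\<close>.\<close>
    then have "card {a1, a2, d1, d2} = 4" using a d by simp
    then have "\<not> {a1, a2, d1, d2} \<subseteq> B'"
      using B'(2) card_mono[of B' "{a1, a2, d1, d2}"] card_ge_0_finite[of B'] by linarith
    then consider t where "t \<in> A" "t \<notin> B'" | t where "t \<in> D" "t \<notin> B'" using a d by blast
    then show ?thesis
    proof cases
      case 1
      obtain c where c: "c \<in> C" "c \<noteq> t" "c \<noteq> d1" using ex_avoiding2[of C] assms by blast
      obtain b where "b \<in> B'" "b \<noteq> c" "b \<noteq> d1" using ex_avoiding2[of B' c d1] B'(2) by auto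
      then have tb: "t \<noteq> b" and bB: "b \<in> B" using 1 B' by auto
      show ?thesis by (rule witness[OF 1(1) bB c(1) d(1)]) (use tb c \<open>b \<noteq> c\<close> \<open>b \<noteq> d1\<close> in simp_all)
    next
      case 2
      obtain c where c: "c \<in> C" "c \<noteq> t" "c \<noteq> a1" using ex_avoiding2[of C] assms by blast
      obtain b where "b \<in> B'" "b \<noteq> c" "b \<noteq> a1" using ex_avoiding2[of B' c a1] B'(2) by auto
      then have tb: "t \<noteq> b" and bB: "b \<in> B" using 2 B' by auto
      show ?thesis by (rule witness[OF a(1) bB c(1) 2(1)]) (use tb c \<open>b \<noteq> c\<close> \<open>b \<noteq> a1\<close> in simp_all)
    qed
  qed
qed

text \<open>
  Consider a vertex colored \<open>c\<close> followed by two vertices of degree 2 with lists \<open>A\<close> and \<open>B\<close>.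
  The colors of \<open>thread_colors A B c\<close> are those that the first of them can take.
\<close>

definition thread_colors :: "'c set \<Rightarrow> 'c set \<Rightarrow> 'c \<Rightarrow> 'c set" where
  "thread_colors A B c = {p \<in> A. p \<noteq> c \<and> (\<exists>q\<in>B. q \<noteq> c \<and> q \<noteq> p)}"

lemma thread_colors_nonempty:
  assumes "3 \<le> card A" "2 \<le> card B"
  shows "thread_colors A B c \<noteq> {}"
proof -
  obtain q where q: "q \<in> B" "q \<noteq> c" using ex_avoiding[OF assms(2)] by blast
  obtain p where "p \<in> A" "p \<noteq> q" "p \<noteq> c" using ex_avoiding2[OF assms(1)] by blast
  then show ?thesis using q by (auto simp: thread_colors_def)
qed

text \<open>\<open>Bad\<close> consists of two colors of \<open>B\<close>. For any other
  \<open>c\<close>, whatever color the first vertex takes from \<open>A - {c}\<close>, one of these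
  two differs from it and serves the second vertex.\<close>

lemma thread_colors_two:
  assumes "3 \<le> card A" "2 \<le> card B"
  shows "\<exists>Bad. finite Bad \<and> card Bad \<le> 2 \<and>
    (\<forall>c. c \<notin> Bad \<longrightarrow> (\<exists>p\<in>thread_colors A B c. \<exists>p'\<in>thread_colors A B c. p \<noteq> p'))"
proof -
  obtain q1 q2 where q: "q1 \<in> B" "q2 \<in> B" "q1 \<noteq> q2" using ex_two[OF assms(2)] .
  have "\<exists>p\<in>thread_colors A B c. \<exists>p'\<in>thread_colors A B c. p \<noteq> p'" if c: "c \<notin> {q1, q2}" for c
  proof -
    have "2 \<le> card (A - {c})" using assms(1) by (intro card_Diff_insert_ge) simp
    then obtain p p' where "p \<in> A - {c}" "p' \<in> A - {c}" "p \<noteq> p'" by (rule ex_two)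
    moreover have "r \<in> thread_colors A B c" if "r \<in> A - {c}" for r
      using that q c by (cases "r = q1") (auto simp: thread_colors_def)
    ultimately show ?thesis by blast
  qed
  then show ?thesis using q by (intro exI[of _ "{q1, q2}"]) auto
qed

text \<open>Double counting of the pairs with \<open>c \<in> Bad t\<close>: there are at most
  \<open>2 * card T\<close> of them, fewer than two for each color of \<open>F\<close>.\<close>

lemma ex_rarely_bad:
  assumes "finite T" "card T < card F" "\<And>t. t \<in> T \<Longrightarrow> finite (Bad t) \<and> card (Bad t) \<le> 2"
  shows "\<exists>c\<in>F. card {t \<in> T. c \<in> Bad t} \<le> 1"
proof (rule ccontr)
  assume "\<not> ?thesis"
  then have two: "2 \<le> card {t \<in> T. c \<in> Bad t}" if "c \<in> F" for c using that by force
  have "card F * 2 \<le> (\<Sum>c\<in>F. card {t \<in> T. c \<in> Bad t})"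
    using sum_bounded_below[of F "2::nat", OF two] by simp
  also have "\<dots> = (\<Sum>c\<in>F. \<Sum>t\<in>{t \<in> T. c \<in> Bad t}. 1)" by simp
  also have "\<dots> = (\<Sum>t\<in>T. \<Sum>c\<in>{c \<in> F. c \<in> Bad t}. 1)"
    using assms(1,2) by (intro sum.swap_restrict) (auto intro: card_ge_0_finite)
  also have "\<dots> = (\<Sum>t\<in>T. card {c \<in> F. c \<in> Bad t})" by simp
  also have "\<dots> \<le> (\<Sum>t\<in>T. 2)"
  proof (rule sum_mono)
    fix t assume "t \<in> T"
    then have "card {c \<in> F. c \<in> Bad t} \<le> card (Bad t)" "card (Bad t) \<le> 2"
      using assms(3) by (auto intro: card_mono)
    then show "card {c \<in> F. c \<in> Bad t} \<le> 2" by linarith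
  qed
  finally show False using assms(2) by simp
qed

text \<open>Let \<open>t0\<close> be the one member that may have a single option, and fix a color
  of it. If this differs from \<open>d\<close>, all others avoid it and it is unique. If it is
  \<open>d\<close>, another member takes some \<open>\<alpha> \<noteq> d\<close>, which
  \<open>t0\<close> avoids by \<open>d\<close> and the rest by their second option.\<close>

lemma ex_unique_color_choice:
  assumes "finite T" "2 \<le> card T" "y \<notin> T" "\<And>t. t \<in> T \<Longrightarrow> M t \<noteq> {}"
    and rare: "card {t \<in> T. \<not> (\<exists>p\<in>M t. \<exists>p'\<in>M t. p \<noteq> p')} \<le> 1"
  shows "\<exists>f. (\<forall>t\<in>T. f t \<in> M t) \<and> f y = d \<and> (\<exists>c. \<exists>!u. u \<in> insert y T \<and> f u = c)"
proof -
  define Q where "Q = {t \<in> T. \<not> (\<exists>p\<in>M t. \<exists>p'\<in>M t. p \<noteq> p')}"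
  have "\<exists>t0\<in>T. Q \<subseteq> {t0}"
  proof (cases "Q = {}")
    case True
    then show ?thesis using assms(2) by (metis card.empty empty_subsetI ex_in_conv not_numeral_le_zero)
  next
    case False
    then obtain t0 where t0: "t0 \<in> Q" by auto
    have "finite Q" using assms(1) by (simp add: Q_def)
    then have "\<forall>a\<in>Q. \<forall>b\<in>Q. a = b" using rare card_le_Suc0_iff_eq[of Q] by (simp add: Q_def)
    then have "Q \<subseteq> {t0}" using t0 by blast
    then show ?thesis using t0 by (auto simp: Q_def)
  qed
  then obtain t0 where t0: "t0 \<in> T" "Q \<subseteq> {t0}" by auto
  have rich: "\<exists>p\<in>M t. p \<noteq> \<gamma>" if tT: "t \<in> T" "t \<noteq> t0" for t \<gamma>
  proof -
    have "t \<notin> Q" using that t0(2) by auto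
    then obtain p p' where "p \<in> M t" "p' \<in> M t" "p \<noteq> p'" using tT(1) by (auto simp: Q_def)
    then show ?thesis by metis
  qed
  obtain \<gamma> where \<gamma>: "\<gamma> \<in> M t0" using assms(4) t0(1) by blast
  obtain t1 where t1: "t1 \<in> T" "t1 \<noteq> t0" using ex_avoiding[OF assms(2)] by blast
  have main: ?thesis if s: "s \<in> T" "\<alpha> \<in> M s" "\<alpha> \<noteq> d"
    and f: "\<forall>t\<in>T. f t \<in> M t" "\<forall>t\<in>T. t \<noteq> s \<longrightarrow> f t \<noteq> \<alpha>" for s \<alpha> f
  proof -
    define f' where "f' = f(s := \<alpha>, y := d)"
    have "\<forall>t\<in>T. f' t \<in> M t" "f' y = d" using assms(3) s f(1) by (auto simp: f'_def)
    moreover have "\<exists>!u. u \<in> insert y T \<and> f' u = \<alpha>"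
      using assms(3) s f(2) by (intro ex1I[of _ s]) (auto simp: f'_def split: if_splits)
    ultimately show ?thesis by blast
  qed
  have choice: "\<exists>f. (\<forall>t\<in>T. f t \<in> M t) \<and> (\<forall>t\<in>T. t \<noteq> s \<longrightarrow> f t \<noteq> \<alpha>)"
    if avoid: "\<And>t. t \<in> T \<Longrightarrow> t \<noteq> s \<Longrightarrow> \<exists>p\<in>M t. p \<noteq> \<alpha>" for s \<alpha>
  proof -
    have "\<exists>p. p \<in> M t \<and> (t \<noteq> s \<longrightarrow> p \<noteq> \<alpha>)" if "t \<in> T" for t
      using avoid[OF that] assms(4)[OF that] by (cases "t = s") auto
    then have "\<forall>t\<in>T. \<exists>p. p \<in> M t \<and> (t \<noteq> s \<longrightarrow> p \<noteq> \<alpha>)" by simp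
    from bchoice[OF this] show ?thesis by blast
  qed
  show ?thesis
  proof (cases "\<gamma> = d")
    case False
    obtain f where f: "\<forall>t\<in>T. f t \<in> M t" "\<forall>t\<in>T. t \<noteq> t0 \<longrightarrow> f t \<noteq> \<gamma>"
      using choice[of t0 \<gamma>] rich by blast
    show ?thesis by (rule main[OF t0(1) \<gamma> False f])
  next
    case True
    obtain \<alpha> where \<alpha>: "\<alpha> \<in> M t1" "\<alpha> \<noteq> d" using rich t1 by blast
    have "\<exists>p\<in>M t. p \<noteq> \<alpha>" if "t \<in> T" for t
      using rich[OF that] \<gamma> \<alpha>(2) True by (cases "t = t0") auto
    then obtain f where f: "\<forall>t\<in>T. f t \<in> M t" "\<forall>t\<in>T. t \<noteq> t1 \<longrightarrow> f t \<noteq> \<alpha>"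
      using choice[of t1 \<alpha>] by blast
    show ?thesis by (rule main[OF t1(1) \<alpha> f])
  qed
qed

section \<open>Colorings of induced subgraphs and their extension\<close>

text \<open>The edge set stays fixed and only \<open>W\<close> shrinks, so that deleting a
  configuration is plain set difference of vertices.\<close>

definition nb :: "'a set set \<Rightarrow> 'a set \<Rightarrow> 'a \<Rightarrow> 'a set" where
  "nb E W v = {u \<in> W. {v, u} \<in> E}"

definition pcf :: "'a set set \<Rightarrow> 'a set \<Rightarrow> ('a \<Rightarrow> 'c) \<Rightarrow> bool" where
  "pcf E W \<phi> \<longleftrightarrow> (\<forall>v\<in>W. \<forall>u\<in>nb E W v. \<phi> v \<noteq> \<phi> u) \<and>
     (\<forall>v\<in>W. nb E W v \<noteq> {} \<longrightarrow> (\<exists>c. \<exists>!u. u \<in> nb E W v \<and> \<phi> u = c))"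

text \<open>An inequality, because degrees drop when vertices are removed while the lists
  stay.\<close>

definition large_lists :: "'a set set \<Rightarrow> 'a set \<Rightarrow> ('a \<Rightarrow> 'c set) \<Rightarrow> bool" where
  "large_lists E W L \<longleftrightarrow> (\<forall>v\<in>W. finite (L v) \<and> card (nb E W v) + 2 \<le> card (L v))"

definition pcf_choosable :: "'c itself \<Rightarrow> 'a set set \<Rightarrow> 'a set \<Rightarrow> bool" where
  "pcf_choosable T E W \<longleftrightarrow>
     (\<forall>L :: 'a \<Rightarrow> 'c set. large_lists E W L \<longrightarrow> (\<exists>\<phi>. pcf E W \<phi> \<and> (\<forall>v\<in>W. \<phi> v \<in> L v)))"

lemma nb_sym: "u \<in> W \<Longrightarrow> v \<in> nb E W u \<Longrightarrow> u \<in> nb E W v"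
  by (auto simp: nb_def insert_commute)

lemma card_2_other: "card N = 2 \<Longrightarrow> u \<in> N \<Longrightarrow> \<exists>w. N = {u, w} \<and> u \<noteq> w"
  by (auto simp: card_2_iff doubleton_eq_iff)

text \<open>
  Let \<open>c x\<close> be a color that occurs exactly once around \<open>x\<close> in the coloring \<open>\<phi>\<close> of \<open>W - S\<close>. The
  condition on \<open>x\<close> survives in every extension to \<open>S\<close> in which no neighbor of \<open>x\<close> receives \<open>c x\<close>.
\<close>

lemma pcf_choosable_extend:
  assumes fin: "finite W" and "S \<subseteq> W" and IH: "pcf_choosable TYPE('c) E (W - S)"
    and out: "\<And>x. x \<in> W - S \<Longrightarrow> nb E W x \<subseteq> S \<Longrightarrow> card (nb E W x) \<le> 1"
    and ext: "\<And>(L :: 'a \<Rightarrow> 'c set) \<phi> c. large_lists E W L \<Longrightarrow>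
       \<exists>\<psi>. (\<forall>x\<in>W - S. \<psi> x = \<phi> x) \<and>
         (\<forall>s\<in>S. \<psi> s \<in> L s \<and> (\<forall>x\<in>nb E W s. \<psi> s \<noteq> \<psi> x) \<and> (\<forall>x\<in>nb E W s - S. \<psi> s \<noteq> c x) \<and>
            (nb E W s \<noteq> {} \<longrightarrow> (\<exists>c. \<exists>!u. u \<in> nb E W s \<and> \<psi> u = c)))"
  shows "pcf_choosable TYPE('c) E W"
  unfolding pcf_choosable_def
proof (intro allI impI)
  fix L :: "'a \<Rightarrow> 'c set"
  assume L: "large_lists E W L"
  have sub: "nb E (W - S) v \<subseteq> nb E W v" for v by (auto simp: nb_def)
  have finnb: "finite (nb E W v)" for v using fin by (simp add: nb_def)
  have "card (nb E (W - S) v) \<le> card (nb E W v)" for v by (rule card_mono[OF finnb sub])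
  then have "large_lists E (W - S) L" using L unfolding large_lists_def by (meson Diff_iff add_le_mono1 order_trans)
  then obtain \<phi> where \<phi>: "pcf E (W - S) \<phi>" "\<forall>v\<in>W - S. \<phi> v \<in> L v"
    using IH unfolding pcf_choosable_def by blast
  have "\<forall>v\<in>W - S. \<exists>c. nb E (W - S) v \<noteq> {} \<longrightarrow> (\<exists>!u. u \<in> nb E (W - S) v \<and> \<phi> u = c)"
    using \<phi>(1) by (simp add: pcf_def)
  from bchoice[OF this] obtain c where
    c: "\<forall>v\<in>W - S. nb E (W - S) v \<noteq> {} \<longrightarrow> (\<exists>!u. u \<in> nb E (W - S) v \<and> \<phi> u = c v)" ..
  obtain \<psi> where \<psi>: "\<And>x. x \<in> W - S \<Longrightarrow> \<psi> x = \<phi> x" "\<And>s. s \<in> S \<Longrightarrow> \<psi> s \<in> L s"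
    "\<And>s x. s \<in> S \<Longrightarrow> x \<in> nb E W s \<Longrightarrow> \<psi> s \<noteq> \<psi> x"
    "\<And>s x. s \<in> S \<Longrightarrow> x \<in> nb E W s - S \<Longrightarrow> \<psi> s \<noteq> c x"
    "\<And>s. s \<in> S \<Longrightarrow> nb E W s \<noteq> {} \<Longrightarrow> \<exists>c. \<exists>!u. u \<in> nb E W s \<and> \<psi> u = c"
    using ext[OF L, of \<phi> c] by blast
  have "\<psi> v \<noteq> \<psi> u" if v: "v \<in> W" "u \<in> nb E W v" for v u
  proof -
    have u: "u \<in> W" "v \<in> nb E W u" using v nb_sym by (auto simp: nb_def insert_commute)
    consider "v \<in> S" | "u \<in> S" | "v \<in> W - S" "u \<in> W - S" using v u by blast
    then show ?thesis
    proof cases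
      case 3
      then have "u \<in> nb E (W - S) v" using v by (auto simp: nb_def)
      then show ?thesis using 3 \<phi>(1) \<psi>(1) unfolding pcf_def by metis
    qed (use \<psi>(3) v u in metis)+
  qed
  moreover have "\<exists>c. \<exists>!u. u \<in> nb E W v \<and> \<psi> u = c" if v: "v \<in> W" "nb E W v \<noteq> {}" for v
  proof (cases "v \<in> S")
    case True
    then show ?thesis using \<psi>(5) v by blast
  next
    case False
    show ?thesis
    proof (cases "nb E (W - S) v = {}")
      case True
      \<comment> \<open>Here the coloring of \<open>W - S\<close> provides no unique color around
        \<open>v\<close> to preserve; instead \<open>out\<close> leaves \<open>v\<close> a single
        neighbor, whose color is unique trivially.\<close>
      then have "nb E W v \<subseteq> S" by (auto simp: nb_def)
      then have "card (nb E W v) \<le> Suc 0" using out False v by simp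
      then have "\<forall>a\<in>nb E W v. \<forall>b\<in>nb E W v. a = b" using card_le_Suc0_iff_eq[OF finnb] by blast
      then show ?thesis using v(2) by (metis ex_in_conv)
    next
      case ne: False
      then obtain u0 where u0: "u0 \<in> nb E (W - S) v" "\<phi> u0 = c v"
        "\<And>u. u \<in> nb E (W - S) v \<Longrightarrow> \<phi> u = c v \<Longrightarrow> u = u0"
        using c v False by blast
      have "\<exists>!u. u \<in> nb E W v \<and> \<psi> u = c v"
      proof (rule ex1I[of _ u0])
        have "u0 \<in> W - S" using u0(1) by (auto simp: nb_def)
        then show "u0 \<in> nb E W v \<and> \<psi> u0 = c v" 
          using subsetD[OF sub u0(1)] u0(2) \<psi>(1) by simp
        fix u assume u: "u \<in> nb E W v \<and> \<psi> u = c v"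
        then have "v \<in> nb E W u" "u \<in> W" using nb_sym v(1) by (auto simp: nb_def insert_commute)
        then have "u \<notin> S" using \<psi>(4)[of u v] False u by blast
        then show "u = u0" using u u0(3) \<psi>(1) by (auto simp: nb_def)
      qed
      then show ?thesis by blast
    qed
  qed
  ultimately have "pcf E W \<psi>" unfolding pcf_def by blast
  moreover have "\<forall>v\<in>W. \<psi> v \<in> L v" using \<psi>(1,2) \<phi>(2) by (metis DiffI)
  ultimately show "\<exists>\<phi>. pcf E W \<phi> \<and> (\<forall>v\<in>W. \<phi> v \<in> L v)" by blast
qed

section \<open>The four reducible configurations\<close>

context
  fixes E :: "'a set set" and W :: "'a set"
  assumes fin: "finite W" and card2: "\<And>e. e \<in> E \<Longrightarrow> card e = 2"
begin

lemma no_loop: "{v, v} \<notin> E"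
  using card2[of "{v, v}"] by auto

lemma nb_irrefl: "v \<notin> nb E W v"
  using no_loop by (simp add: nb_def)

lemma finite_nb: "finite (nb E W v)"
  using fin by (simp add: nb_def)

text \<open>A vertex with one neighbor \<open>w\<close> has three colors and avoids two, the color
  of \<open>w\<close> and the color kept unique around \<open>w\<close>. Its own condition holds
  because it has at most one neighbor.\<close>

lemma reducible_leaf:
  assumes "v \<in> W" "card (nb E W v) \<le> 1" "pcf_choosable TYPE('c) E (W - {v})"
  shows "pcf_choosable TYPE('c) E W"
proof (rule pcf_choosable_extend[OF fin _ assms(3)])
  show "{v} \<subseteq> W" using assms(1) by simp
  show "card (nb E W x) \<le> 1" if "nb E W x \<subseteq> {v}" for x
    using card_mono[OF _ that] by simp
  fix L :: "'a \<Rightarrow> 'c set" and \<phi> c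
  assume L: "large_lists E W L"
  have eq: "\<forall>a\<in>nb E W v. \<forall>b\<in>nb E W v. a = b"
    using assms(2) card_le_Suc0_iff_eq[OF finite_nb] by simp
  obtain w where w: "nb E W v \<subseteq> {w}"
  proof (cases "nb E W v = {}")
    case False
    then obtain w where "w \<in> nb E W v" by auto
    then show ?thesis using that[of w] eq by blast
  qed (use that in auto)
  have "\<exists>col\<in>L v. \<forall>x\<in>nb E W v. col \<noteq> \<phi> x \<and> col \<noteq> c x"
  proof (cases "nb E W v = {}")
    case True
    have "2 \<le> card (L v)" using L assms(1) by (auto simp: large_lists_def)
    then show ?thesis using ex_two[of "L v"] True by (metis empty_iff)
  next
    case False
    then have "nb E W v = {w}" using w by auto
    then have "3 \<le> card (L v)" using L assms(1) by (auto simp: large_lists_def)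
    then show ?thesis using ex_avoiding2[of "L v" "\<phi> w" "c w"] w by auto
  qed
  then obtain col where col: "col \<in> L v" "\<And>x. x \<in> nb E W v \<Longrightarrow> col \<noteq> \<phi> x \<and> col \<noteq> c x" by blast
  define \<psi> where "\<psi> = \<phi>(v := col)"
  have "\<psi> v \<noteq> \<psi> x" if "x \<in> nb E W v" for x
    using col(2)[OF that] nb_irrefl[of v] that by (auto simp: \<psi>_def)
  moreover have "nb E W v \<noteq> {} \<longrightarrow> (\<exists>c. \<exists>!u. u \<in> nb E W v \<and> \<psi> u = c)"
    using eq by (metis ex_in_conv)
  moreover have "\<forall>x\<in>W - {v}. \<psi> x = \<phi> x" "\<psi> v = col" by (auto simp: \<psi>_def)
  ultimately show "\<exists>\<psi>. (\<forall>x\<in>W - {v}. \<psi> x = \<phi> x) \<and>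
         (\<forall>s\<in>{v}. \<psi> s \<in> L s \<and> (\<forall>x\<in>nb E W s. \<psi> s \<noteq> \<psi> x) \<and> (\<forall>x\<in>nb E W s - {v}. \<psi> s \<noteq> c x) \<and>
            (nb E W s \<noteq> {} \<longrightarrow> (\<exists>c. \<exists>!u. u \<in> nb E W s \<and> \<psi> u = c)))"
    using col by (intro exI[of _ \<psi>]) auto
qed

context
  assumes girth: "\<And>p. cyc E p \<Longrightarrow> 7 \<le> length p"
begin

text \<open>These four lengths are the ones that arise below; the longest, 6, comes from two threads
  at a vertex that end in the same outer vertex.\<close>

lemma no_short_cycle:
  "a \<in> nb E W b \<Longrightarrow> b \<in> nb E W c \<Longrightarrow> c \<in> nb E W a \<Longrightarrow> distinct [a, b, c] \<Longrightarrow> False"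
  "a \<in> nb E W b \<Longrightarrow> b \<in> nb E W c \<Longrightarrow> c \<in> nb E W d \<Longrightarrow> d \<in> nb E W a \<Longrightarrow> distinct [a, b, c, d] \<Longrightarrow> False"
  "a \<in> nb E W b \<Longrightarrow> b \<in> nb E W c \<Longrightarrow> c \<in> nb E W d \<Longrightarrow> d \<in> nb E W e \<Longrightarrow> e \<in> nb E W a \<Longrightarrow>
    distinct [a, b, c, d, e] \<Longrightarrow> False"
  "a \<in> nb E W b \<Longrightarrow> b \<in> nb E W c \<Longrightarrow> c \<in> nb E W d \<Longrightarrow> d \<in> nb E W e \<Longrightarrow> e \<in> nb E W f \<Longrightarrow> f \<in> nb E W a \<Longrightarrow>
    distinct [a, b, c, d, e, f] \<Longrightarrow> False"
  using girth[of "[a, b, c]"] girth[of "[a, b, c, d]"] girth[of "[a, b, c, d, e]"] girth[of "[a, b, c, d, e, f]"]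
  by (simp_all add: cyc_def nb_def insert_commute)

text \<open>Each of the four vertices has degree 2, so the new colors must differ at distance 1 and
  at distance 2. This is a list coloring of the square of the path.\<close>

lemma reducible_path:
  assumes W: "a \<in> W" "b \<in> W" "c \<in> W" "d \<in> W"
    and na: "nb E W a = {x, b}" "x \<noteq> b" and nbb: "nb E W b = {a, c}" "a \<noteq> c"
    and nc: "nb E W c = {b, d}" "b \<noteq> d" and nd: "nb E W d = {c, y}" "c \<noteq> y"
    and IH: "pcf_choosable TYPE('c) E (W - {a, b, c, d})"
  shows "pcf_choosable TYPE('c) E W"
proof -
  have irr: "a \<noteq> b" "b \<noteq> c" "c \<noteq> d" "x \<noteq> a" "y \<noteq> d"
    using nb_irrefl[of a] nb_irrefl[of b] nb_irrefl[of c] nb_irrefl[of d] na nbb nc nd by auto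
  have xy: "x \<in> W" "y \<in> W" using na nd by (auto simp: nb_def)
  have nx: "a \<in> nb E W x" and ny: "d \<in> nb E W y" 
    using nb_sym[OF W(1), of x] nb_sym[OF W(4), of y] na(1) nd(1) by simp_all
  have ad: "a \<noteq> d" using no_short_cycle(1)[of a b c] na nbb nc nd irr by auto
  have xc: "x \<noteq> c" using no_short_cycle(1)[of a b c] na nbb nc nx irr by auto
  have xd: "x \<noteq> d" using no_short_cycle(2)[of a b c d] na nbb nc nd nx irr ad by auto
  have yb: "y \<noteq> b" using no_short_cycle(1)[of b c d] na nbb nc nd ny irr by auto
  have ya: "y \<noteq> a" using no_short_cycle(2)[of a b c d] na nbb nc nd ny irr ad by auto
  have xy': "x \<noteq> y"
    using no_short_cycle(3)[of x a b c d] na nbb nc nd nx ny irr ad xc xd by auto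
  show ?thesis
  proof (rule pcf_choosable_extend[OF fin _ IH])
    show "{a, b, c, d} \<subseteq> W" using W by simp
    fix z assume z: "z \<in> W - {a, b, c, d}" "nb E W z \<subseteq> {a, b, c, d}"
    have "s = a \<and> z = x \<or> s = d \<and> z = y" if s: "s \<in> nb E W z" for s
    proof -
      have zs: "z \<in> nb E W s" using nb_sym[OF _ s] z(1) by simp
      consider "s = a" | "s = b" | "s = c" | "s = d" using s z(2) by blast
      then show ?thesis by cases (use zs z(1) na(1) nbb(1) nc(1) nd(1) in simp_all)
    qed
    then have "\<forall>s\<in>nb E W z. \<forall>t\<in>nb E W z. s = t" using xy' by blast
    then show "card (nb E W z) \<le> 1" using card_le_Suc0_iff_eq[OF finite_nb] by simp
  next
    fix L :: "'a \<Rightarrow> 'c set" and \<phi> k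
    assume L: "large_lists E W L"
    have "4 \<le> card (L a)" "4 \<le> card (L b)" "4 \<le> card (L c)" "4 \<le> card (L d)"
      using L W na nbb nc nd by (auto simp: large_lists_def)
    \<comment> \<open>The ends lose two colors to their outer neighbors. The inner vertex
      \<open>b\<close> loses \<open>\<phi> x\<close>, since the condition at \<open>a\<close>
      separates \<open>b\<close> from \<open>x\<close>; likewise \<open>c\<close> loses
      \<open>\<phi> y\<close>.\<close>
    then have "2 \<le> card (L a - {\<phi> x, k x})" "3 \<le> card (L b - {\<phi> x})"
      "3 \<le> card (L c - {\<phi> y})" "2 \<le> card (L d - {\<phi> y, k y})"
      by (auto intro: card_Diff_insert_ge card_Diff_insert2_ge)
    then obtain ca cb cc cd where col: "ca \<in> L a - {\<phi> x, k x}" "cb \<in> L b - {\<phi> x}"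
      "cc \<in> L c - {\<phi> y}" "cd \<in> L d - {\<phi> y, k y}"
      "ca \<noteq> cb" "ca \<noteq> cc" "cb \<noteq> cc" "cb \<noteq> cd" "cc \<noteq> cd"
      using square_path_choosable[of "L a - {\<phi> x, k x}" "L b - {\<phi> x}" "L c - {\<phi> y}" "L d - {\<phi> y, k y}"]
      by blast
    define \<psi> where "\<psi> = \<phi>(a := ca, b := cb, c := cc, d := cd)"
    have \<psi>: "\<psi> a = ca" "\<psi> b = cb" "\<psi> c = cc" "\<psi> d = cd" "\<psi> x = \<phi> x" "\<psi> y = \<phi> y"
      using irr ad xc xd yb ya na nbb nc nd by (auto simp: \<psi>_def)
    have "\<exists>col. \<exists>!u. u \<in> nb E W a \<and> \<psi> u = col" "\<exists>col. \<exists>!u. u \<in> nb E W b \<and> \<psi> u = col"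
      "\<exists>col. \<exists>!u. u \<in> nb E W c \<and> \<psi> u = col" "\<exists>col. \<exists>!u. u \<in> nb E W d \<and> \<psi> u = col"
      using ex1_color_pair[OF na(1), of \<psi>] ex1_color_pair[OF nbb(1), of \<psi>]
        ex1_color_pair[OF nc(1), of \<psi>] ex1_color_pair[OF nd(1), of \<psi>] col \<psi> by auto
    moreover have "\<forall>z\<in>W - {a, b, c, d}. \<psi> z = \<phi> z" by (auto simp: \<psi>_def)
    ultimately show "\<exists>\<psi>. (\<forall>x\<in>W - {a, b, c, d}. \<psi> x = \<phi> x) \<and>
         (\<forall>s\<in>{a, b, c, d}. \<psi> s \<in> L s \<and> (\<forall>x\<in>nb E W s. \<psi> s \<noteq> \<psi> x) \<and>
            (\<forall>x\<in>nb E W s - {a, b, c, d}. \<psi> s \<noteq> k x) \<and>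
            (nb E W s \<noteq> {} \<longrightarrow> (\<exists>c. \<exists>!u. u \<in> nb E W s \<and> \<psi> u = c)))"
      using col \<psi> na(1) nbb(1) nc(1) nd(1) by (intro exI[of _ \<psi>]) auto
  qed
qed

text \<open>Color \<open>v\<close> so that at most one thread leaves its first vertex without two
  options; then the first vertices can be colored with a unique color around \<open>v\<close>, and
  the second ones last. By the girth the outer vertices \<open>y\<close> and \<open>h t\<close> are
  distinct, so none of them has two neighbors in the removed set.\<close>

lemma reducible_star:
  assumes v: "v \<in> W" and nv: "nb E W v = insert y T" "y \<notin> T" and T: "2 \<le> card T"
    and nt: "\<And>t. t \<in> T \<Longrightarrow> nb E W t = {v, q t} \<and> v \<noteq> q t"
    and nq: "\<And>t. t \<in> T \<Longrightarrow> nb E W (q t) = {t, h t} \<and> t \<noteq> h t"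
    and IH: "pcf_choosable TYPE('c) E (W - ({v} \<union> T \<union> q ` T))"
  shows "pcf_choosable TYPE('c) E W"
proof -
  define S where "S = {v} \<union> T \<union> q ` T"
  have TW: "t \<in> W" "q t \<in> W" "h t \<in> W" if "t \<in> T" for t
    using that nv(1) nt[OF that] nq[OF that] by (auto simp: nb_def)
  have finT: "finite T" using T by (metis card.infinite not_numeral_le_zero)
  have yW: "y \<in> W" using nv(1) by (auto simp: nb_def)
  have tv: "t \<in> nb E W v" "v \<in> nb E W t" "q t \<in> nb E W t" "t \<in> nb E W (q t)" "h t \<in> nb E W (q t)"
    "q t \<in> nb E W (h t)" if "t \<in> T" for t
    using nv nt[OF that] nq[OF that] that nb_sym[of "q t" W "h t" E] TW[OF that] by auto
  have yv: "y \<in> nb E W v" "v \<in> nb E W y" using nv(1) nb_sym[OF v, of y] by auto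
  have irr: "t \<noteq> v" "t \<noteq> q t" "q t \<noteq> h t" if "t \<in> T" for t
    using tv[OF that] nb_irrefl[of t] nb_irrefl[of "q t"] by auto
  have yv': "y \<noteq> v" using yv nb_irrefl by auto
  have qT: "q t \<notin> T" if "t \<in> T" for t
    using no_short_cycle(1)[of v t "q t"] tv[OF that] tv[of "q t"] irr[OF that] nt[OF that] by auto
  have qinj: "inj_on q T"
  proof (rule inj_onI, rule ccontr)
    fix s t assume st: "s \<in> T" "t \<in> T" "q s = q t" "s \<noteq> t"
    then show False
      using no_short_cycle(2)[of v s "q s" t] tv[of s] tv[of t] irr[of s] irr[of t] nt[of s] by auto
  qed
  have hv: "h t \<noteq> v" if "t \<in> T" for t
    using no_short_cycle(1)[of v t "q t"] tv[OF that] irr[OF that] nt[OF that] by auto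
  have hT: "h t \<notin> T" if "t \<in> T" for t
    using no_short_cycle(2)[of v t "q t" "h t"] tv[OF that] tv[of "h t"] irr[OF that] irr[of "h t"]
      nt[OF that] nq[OF that] by auto
  have hq: "h t \<noteq> q s" if "t \<in> T" "s \<in> T" for s t
  proof
    assume eq: "h t = q s"
    have "s \<noteq> t" using eq irr[OF that(1)] by auto
    moreover have "q s \<noteq> q t" using eq irr[OF that(1)] by auto
    moreover have "s \<noteq> q t" "t \<noteq> q s" using qT that by auto
    ultimately show False
      using no_short_cycle(3)[of v t "q t" "q s" s] eq tv[OF that(1)] tv[OF that(2)] irr[OF that(1)]
        irr[OF that(2)] nt[OF that(1)] nt[OF that(2)] by auto
  qed
  have hS: "h t \<notin> S" if "t \<in> T" for t using hv hT hq that by (auto simp: S_def)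
  have hinj: "h s \<noteq> h t" if "s \<in> T" "t \<in> T" "s \<noteq> t" for s t
  proof
    assume eq: "h s = h t"
    have "q s \<noteq> q t" using inj_onD[OF qinj] that by blast
    moreover have "s \<noteq> q t" "t \<noteq> q s" using qT that by auto
    moreover have "h t \<noteq> t" "h t \<noteq> s" "h t \<noteq> q s" "h t \<noteq> q t" 
      using hT[OF that(2)] hq[OF that(2) that(1)] hq[OF that(2) that(2)] that by auto
    ultimately show False
      using no_short_cycle(4)[of v s "q s" "h s" "q t" t] eq tv[OF that(1)] tv[OF that(2)] irr[OF that(1)]
        irr[OF that(2)] nt[OF that(1)] nt[OF that(2)] hv[OF that(1)] that(3) by auto
  qed
  have yq: "y \<noteq> q s" if "s \<in> T" for s
    using no_short_cycle(1)[of v s y] yv tv[OF that] irr[OF that] nt[OF that] nv(2) that by auto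
  have yS: "y \<notin> S" using yv' nv(2) yq by (auto simp: S_def)
  have yh: "y \<noteq> h t" if "t \<in> T" for t
    using no_short_cycle(2)[of v t "q t" y] yv tv[OF that] irr[OF that] nt[OF that] nq[OF that] nv(2) that yv' yq by auto
  show ?thesis
  proof (rule pcf_choosable_extend[OF fin _ IH, folded S_def])
    show "S \<subseteq> W" using v TW by (auto simp: S_def)
    fix z assume z: "z \<in> W - S" "nb E W z \<subseteq> S"
    have "s = v \<and> z = y \<or> (\<exists>t\<in>T. s = q t \<and> z = h t)" if s: "s \<in> nb E W z" for s
    proof -
      have zs: "z \<in> nb E W s" using nb_sym[OF _ s] z(1) by simp
      have "s \<in> S" using s z(2) by auto
      then consider "s = v" | "s \<in> T" | t where "t \<in> T" "s = q t" by (auto simp: S_def)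
      then show ?thesis
      proof cases
        case 1
        then show ?thesis using zs nv z by (auto simp: S_def)
      next
        case 2
        then show ?thesis using zs nt[OF 2] z by (auto simp: S_def)
      next
        case 3
        then show ?thesis using zs nq[OF 3(1)] z by (auto simp: S_def)
      qed
    qed
    then have "\<forall>s\<in>nb E W z. \<forall>t\<in>nb E W z. s = t" using yh hinj by metis
    then show "card (nb E W z) \<le> 1" using card_le_Suc0_iff_eq[OF finite_nb] by simp
  next
    fix L :: "'a \<Rightarrow> 'c set" and \<phi> k
    assume L: "large_lists E W L"
    \<comment> \<open>The list of \<open>v\<close> has \<open>card T + 3\<close> colors and loses
      two to \<open>y\<close>, which still leaves more colors than threads. The vertex
      \<open>t\<close> loses \<open>\<phi> (h t)\<close> because of the condition at
      \<open>q t\<close>, and \<open>q t\<close> loses two colors to its outer neighbor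
      \<open>h t\<close>.\<close>
    define F where "F = L v - {\<phi> y, k y}"
    define A where "A = (\<lambda>t. L t - {\<phi> (h t)})"
    define B where "B = (\<lambda>t. L (q t) - {\<phi> (h t), k (h t)})"
    have "card T + 3 \<le> card (L v)" using L v nv finT by (auto simp: large_lists_def)
    then have F: "card T < card F"
      using card_Diff_insert2_ge[of "card T + 1" "L v" "\<phi> y" "k y"] by (simp add: F_def)
    have A: "3 \<le> card (A t)" and B: "2 \<le> card (B t)" if "t \<in> T" for t
    proof -
      have "4 \<le> card (L t)" "4 \<le> card (L (q t))"
        using L TW[OF that] nt[OF that] nq[OF that] by (auto simp: large_lists_def)
      then show "3 \<le> card (A t)" "2 \<le> card (B t)"
        by (auto simp: A_def B_def intro: card_Diff_insert_ge card_Diff_insert2_ge)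
    qed
    let ?O = "\<lambda>c t. thread_colors (A t) (B t) c"
    have "\<forall>t\<in>T. \<exists>Bad. finite Bad \<and> card Bad \<le> 2 \<and>
        (\<forall>c. c \<notin> Bad \<longrightarrow> (\<exists>p\<in>?O c t. \<exists>p'\<in>?O c t. p \<noteq> p'))"
      using thread_colors_two A B by blast
    then obtain Bad where Bad: "\<And>t. t \<in> T \<Longrightarrow> finite (Bad t) \<and> card (Bad t) \<le> 2"
      "\<And>t c. t \<in> T \<Longrightarrow> c \<notin> Bad t \<Longrightarrow> \<exists>p\<in>?O c t. \<exists>p'\<in>?O c t. p \<noteq> p'"
      using bchoice[of T] by (metis (no_types, lifting))
    obtain c where c: "c \<in> F" "card {t \<in> T. c \<in> Bad t} \<le> 1"
      using ex_rarely_bad[of T F Bad, OF finT F Bad(1)] by blast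
    have sub: "{t \<in> T. \<not> (\<exists>p\<in>?O c t. \<exists>p'\<in>?O c t. p \<noteq> p')} \<subseteq> {t \<in> T. c \<in> Bad t}"
      using Bad(2) by blast
    have rare: "card {t \<in> T. \<not> (\<exists>p\<in>?O c t. \<exists>p'\<in>?O c t. p \<noteq> p')} \<le> 1"
      by (rule order_trans[OF card_mono[OF _ sub] c(2)]) (simp add: finT)
    have ne: "?O c t \<noteq> {}" if "t \<in> T" for t
      by (rule thread_colors_nonempty[OF A[OF that] B[OF that]])
    obtain p where p: "\<forall>t\<in>T. p t \<in> ?O c t" "p y = \<phi> y" "\<exists>col. \<exists>!u. u \<in> insert y T \<and> p u = col"
      using ex_unique_color_choice[of T y "?O c" "\<phi> y", OF finT T nv(2) ne rare] by blast
    have "\<forall>t\<in>T. \<exists>r. r \<in> B t \<and> r \<noteq> c \<and> r \<noteq> p t" using p(1) by (auto simp: thread_colors_def)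
    then obtain r where r: "\<And>t. t \<in> T \<Longrightarrow> r t \<in> B t \<and> r t \<noteq> c \<and> r t \<noteq> p t" using bchoice[of T] by metis
    \<comment> \<open>By injectivity of \<open>q\<close> on \<open>T\<close> and
      \<open>q t \<notin> T\<close>, the vertex \<open>q t\<close> receives exactly
      \<open>r t\<close>.\<close>
    define \<psi> where "\<psi> = (\<lambda>x. if x = v then c else if x \<in> T then p x
      else if x \<in> q ` T then r (inv_into T q x) else \<phi> x)"
    have \<psi>v: "\<psi> v = c" by (simp add: \<psi>_def)
    have \<psi>t: "\<psi> t = p t" if "t \<in> T" for t using that irr by (auto simp: \<psi>_def)
    have \<psi>q: "\<psi> (q t) = r t" if "t \<in> T" for t
      using that qT[OF that] nt[OF that] qinj by (auto simp: \<psi>_def)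
    have \<psi>o: "\<psi> x = \<phi> x" if "x \<notin> S" for x using that by (auto simp: \<psi>_def S_def)
    have pt: "p t \<in> L t" "p t \<noteq> \<phi> (h t)" "p t \<noteq> c" if "t \<in> T" for t
      using p(1) that by (auto simp: thread_colors_def A_def)
    have rt: "r t \<in> L (q t)" "r t \<noteq> \<phi> (h t)" "r t \<noteq> k (h t)" "r t \<noteq> c" "r t \<noteq> p t" if "t \<in> T" for t
      using r[OF that] by (auto simp: B_def)
    let ?good = "\<lambda>s. \<psi> s \<in> L s \<and> (\<forall>x\<in>nb E W s. \<psi> s \<noteq> \<psi> x) \<and> (\<forall>x\<in>nb E W s - S. \<psi> s \<noteq> k x) \<and>
            (nb E W s \<noteq> {} \<longrightarrow> (\<exists>c. \<exists>!u. u \<in> nb E W s \<and> \<psi> u = c))"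
    have "?good v"
    proof -
      have "\<psi> u = p u" if "u \<in> insert y T" for u using that \<psi>t \<psi>o[OF yS] p(2) by auto
      then have "(u \<in> nb E W v \<and> \<psi> u = col) = (u \<in> insert y T \<and> p u = col)" for u col
        unfolding nv by auto
      then have "\<exists>col. \<exists>!u. u \<in> nb E W v \<and> \<psi> u = col" using p(3) by simp
      moreover have "c \<in> L v" "c \<noteq> \<phi> y" "c \<noteq> k y" using c(1) by (auto simp: F_def)
      ultimately show ?thesis
        using pt(3) \<psi>o[OF yS] \<psi>t unfolding \<psi>v nv(1) by (auto simp: S_def)
    qed
    moreover have "?good t" if t: "t \<in> T" for t
    proof -
      have n: "nb E W t = {v, q t}" using nt[OF t] by simp
      have "\<exists>col. \<exists>!u. u \<in> nb E W t \<and> \<psi> u = col"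
        using ex1_color_pair[OF n, of \<psi>] rt(4)[OF t] \<psi>v \<psi>q[OF t] by simp
      then show ?thesis using pt[OF t] rt[OF t] \<psi>v \<psi>t[OF t] \<psi>q[OF t] t unfolding n by (auto simp: S_def)
    qed
    moreover have "?good (q t)" if t: "t \<in> T" for t
    proof -
      have n: "nb E W (q t) = {t, h t}" using nq[OF t] by simp
      have "\<exists>col. \<exists>!u. u \<in> nb E W (q t) \<and> \<psi> u = col"
        using ex1_color_pair[OF n, of \<psi>] pt[OF t] \<psi>t[OF t] \<psi>o[OF hS[OF t]] by simp
      then show ?thesis using pt[OF t] rt[OF t] \<psi>t[OF t] \<psi>q[OF t] \<psi>o[OF hS[OF t]] t
        unfolding n by (auto simp: S_def)
    qed
    ultimately have "\<forall>s\<in>S. ?good s" by (auto simp: S_def)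
    then show "\<exists>\<psi>. (\<forall>x\<in>W - S. \<psi> x = \<phi> x) \<and>
         (\<forall>s\<in>S. \<psi> s \<in> L s \<and> (\<forall>x\<in>nb E W s. \<psi> s \<noteq> \<psi> x) \<and> (\<forall>x\<in>nb E W s - S. \<psi> s \<noteq> k x) \<and>
            (nb E W s \<noteq> {} \<longrightarrow> (\<exists>c. \<exists>!u. u \<in> nb E W s \<and> \<psi> u = c)))"
      using \<psi>o by (intro exI[of _ \<psi>]) auto
  qed
qed

text \<open>The colors are chosen in the order \<open>b\<close>, \<open>v\<close>, \<open>a\<close>,
  \<open>q\<close>. If \<open>b\<close> differs from \<open>y\<close>, the third neighbor
  \<open>a\<close> of \<open>v\<close> can repeat only one of their colors, so the other one is
  unique around \<open>v\<close>.\<close>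

lemma reducible_cubic:
  assumes v: "v \<in> W" and nv: "nb E W v = {a, b, y}" "distinct [a, b, y]"
    and na: "nb E W a = {v, q}" "v \<noteq> q" and nq: "nb E W q = {a, x}" "a \<noteq> x"
    and nbb: "nb E W b = {v, z}" "v \<noteq> z"
    and IH: "pcf_choosable TYPE('c) E (W - {v, a, q, b})"
  shows "pcf_choosable TYPE('c) E W"
proof -
  have W: "a \<in> W" "b \<in> W" "y \<in> W" using nv by (auto simp: nb_def)
  have W': "q \<in> W" "x \<in> W" "z \<in> W" using na nq nbb by (auto simp: nb_def)
  have ns: "v \<in> nb E W y" "q \<in> nb E W x" "b \<in> nb E W z"
    using nb_sym[OF v, of y] nb_sym[OF W'(1), of x] nb_sym[OF W(2), of z] nv nq nbb by auto
  have irr: "v \<noteq> a" "v \<noteq> b" "v \<noteq> y" "a \<noteq> q" "q \<noteq> x" "b \<noteq> z"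
    using nb_irrefl[of v] nb_irrefl[of a] nb_irrefl[of q] nb_irrefl[of b] nv na nq nbb by auto
  have ab: "a \<noteq> b" "a \<noteq> y" "b \<noteq> y" using nv(2) by auto
  have qb: "q \<noteq> b" using no_short_cycle(1)[of v a b] nv na nq nbb irr ab by auto
  have qy: "q \<noteq> y" using no_short_cycle(1)[of v a y] nv na nq ns irr ab by auto
  have xv: "x \<noteq> v" using no_short_cycle(1)[of v a q] nv na nq ns irr ab by auto
  have xb: "x \<noteq> b" using no_short_cycle(2)[of v a q b] nv na nq nbb ns irr ab qb by auto
  have za: "z \<noteq> a" using no_short_cycle(1)[of v a b] nv na nbb ns irr ab by auto
  have zq: "z \<noteq> q" using no_short_cycle(2)[of v a q b] nv na nq nbb ns irr ab qb by auto
  have xy: "x \<noteq> y" using no_short_cycle(2)[of v a q y] nv na nq ns irr ab qy by auto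
  have xz: "x \<noteq> z" using no_short_cycle(3)[of v a q x b] nv na nq nbb ns irr ab qb xv xb by auto
  have yz: "y \<noteq> z" using no_short_cycle(1)[of v b y] nv nbb ns irr ab by auto
  show ?thesis
  proof (rule pcf_choosable_extend[OF fin _ IH])
    show "{v, a, q, b} \<subseteq> W" using v W W' by simp
    fix w assume w: "w \<in> W - {v, a, q, b}" "nb E W w \<subseteq> {v, a, q, b}"
    have "s = v \<and> w = y \<or> s = q \<and> w = x \<or> s = b \<and> w = z" if s: "s \<in> nb E W w" for s
    proof -
      have ws: "w \<in> nb E W s" using nb_sym[OF _ s] w(1) by simp
      consider "s = v" | "s = a" | "s = q" | "s = b" using s w(2) by blast
      then show ?thesis by cases (use ws w(1) nv(1) na(1) nq(1) nbb(1) in simp_all)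
    qed
    then have "\<forall>s\<in>nb E W w. \<forall>t\<in>nb E W w. s = t" using xy xz yz by blast
    then show "card (nb E W w) \<le> 1" using card_le_Suc0_iff_eq[OF finite_nb] by simp
  next
    fix L :: "'a \<Rightarrow> 'c set" and \<phi> k
    assume L: "large_lists E W L"
    have "5 \<le> card (L v)" "4 \<le> card (L a)" "4 \<le> card (L q)" "4 \<le> card (L b)"
      using L v W W' nv na nq nbb by (auto simp: large_lists_def)
    then have cards: "3 \<le> card (L v - {\<phi> y, k y})" "3 \<le> card (L a - {\<phi> x})"
      "2 \<le> card (L q - {\<phi> x, k x})" "2 \<le> card (L b - {\<phi> z, k z})"
      by (auto intro: card_Diff_insert_ge card_Diff_insert2_ge)
    obtain cb where cb: "cb \<in> L b - {\<phi> z, k z}" "cb \<noteq> \<phi> y" using ex_avoiding[OF cards(4)] by blast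
    \<comment> \<open>Avoiding \<open>\<phi> z\<close> serves the condition at \<open>b\<close>,
      whose neighbors are \<open>v\<close> and \<open>z\<close>. The three remaining colors of
      \<open>v\<close> suffice for this and for \<open>cb\<close>.\<close>
    obtain cv where cv: "cv \<in> L v - {\<phi> y, k y}" "cv \<noteq> \<phi> z" "cv \<noteq> cb"
      using ex_avoiding2[OF cards(1)] by blast
    obtain ca where "ca \<in> thread_colors (L a - {\<phi> x}) (L q - {\<phi> x, k x}) cv"
      using thread_colors_nonempty[OF cards(2,3)] by blast
    then obtain cq where ca: "ca \<in> L a - {\<phi> x}" "ca \<noteq> cv" and cq: "cq \<in> L q - {\<phi> x, k x}" "cq \<noteq> cv" "cq \<noteq> ca"
      by (auto simp: thread_colors_def)
    define \<psi> where "\<psi> = \<phi>(v := cv, a := ca, q := cq, b := cb)"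
    have \<psi>: "\<psi> v = cv" "\<psi> a = ca" "\<psi> q = cq" "\<psi> b = cb" "\<psi> x = \<phi> x" "\<psi> y = \<phi> y" "\<psi> z = \<phi> z"
      using irr ab qb qy xv xb za zq na nq nbb by (auto simp: \<psi>_def)
    have "\<exists>col. \<exists>!u. u \<in> nb E W v \<and> \<psi> u = col"
    proof (cases "ca = cb")
      case True
      then show ?thesis using nv(1) cb \<psi> by (intro exI[of _ "\<phi> y"] ex1I[of _ y]) auto
    next
      case False
      then show ?thesis using nv(1) cb \<psi> by (intro exI[of _ cb] ex1I[of _ b]) auto
    qed
    moreover have "\<exists>col. \<exists>!u. u \<in> nb E W a \<and> \<psi> u = col" "\<exists>col. \<exists>!u. u \<in> nb E W q \<and> \<psi> u = col"
      "\<exists>col. \<exists>!u. u \<in> nb E W b \<and> \<psi> u = col"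
      using ex1_color_pair[OF na(1), of \<psi>] ex1_color_pair[OF nq(1), of \<psi>]
        ex1_color_pair[OF nbb(1), of \<psi>] ca cb cv cq \<psi> by auto
    moreover have "\<forall>w\<in>W - {v, a, q, b}. \<psi> w = \<phi> w" by (auto simp: \<psi>_def)
    ultimately show "\<exists>\<psi>. (\<forall>x\<in>W - {v, a, q, b}. \<psi> x = \<phi> x) \<and>
         (\<forall>s\<in>{v, a, q, b}. \<psi> s \<in> L s \<and> (\<forall>x\<in>nb E W s. \<psi> s \<noteq> \<psi> x) \<and>
            (\<forall>x\<in>nb E W s - {v, a, q, b}. \<psi> s \<noteq> k x) \<and>
            (nb E W s \<noteq> {} \<longrightarrow> (\<exists>c. \<exists>!u. u \<in> nb E W s \<and> \<psi> u = c)))"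
      using ca cb cv cq \<psi> nv(1) na(1) nq(1) nbb(1) by (intro exI[of _ \<psi>]) auto
  qed
qed

end

end

section \<open>Discharging\<close>

text \<open>
  The initial charge of a vertex of degree \<open>d\<close> is \<open>5 d - 12\<close>. The last case of \<open>transfer\<close> serves the
  middle one of three consecutive vertices of degree 2, which no vertex of larger degree can reach.
\<close>

context
  fixes E :: "'a set set" and W :: "'a set"
  assumes fin: "finite W" and card2: "\<And>e. e \<in> E \<Longrightarrow> card e = 2"
begin

text \<open>Such a neighbor asks \<open>v\<close> for charge 3: it lacks 2, and it may have to hand
  1 on to the middle of a path of three vertices of degree 2.\<close>

definition heavy :: "'a \<Rightarrow> 'a \<Rightarrow> bool" where
  "heavy v t \<longleftrightarrow> card (nb E W t) = 2 \<and> (\<exists>q\<in>nb E W t. q \<noteq> v \<and> card (nb E W q) = 2)"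

definition transfer :: "'a \<Rightarrow> 'a \<Rightarrow> int" where
  "transfer v u =
     (if card (nb E W u) \<noteq> 2 then 0
      else if 3 \<le> card (nb E W v) then (if heavy v u then 3 else 1)
      else if card (nb E W v) = 2 \<and> (\<forall>w\<in>nb E W u. card (nb E W w) = 2) \<and> (\<exists>w\<in>nb E W v. 3 \<le> card (nb E W w))
      then 1 else 0)"

lemma transfer_nonneg: "0 \<le> transfer v u"
  by (simp add: transfer_def)

lemma transfer_le_3: "transfer v u \<le> 3"
  by (simp add: transfer_def)

lemma transfer_sum_swap: "(\<Sum>v\<in>W. \<Sum>u\<in>nb E W v. transfer u v) = (\<Sum>v\<in>W. \<Sum>u\<in>nb E W v. transfer v u)"
  unfolding nb_def using sum.swap_restrict[OF fin fin, of "\<lambda>v u. transfer u v" "\<lambda>v u. {v, u} \<in> E"]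
  by (simp add: insert_commute)

text \<open>With \<open>h\<close> heavy neighbors at most \<open>d + 2 h\<close> is sent. For
  \<open>h \<le> d - 2\<close> this is at most \<open>3 d - 4 \<le> 5 d - 12\<close> if
  \<open>d \<ge> 4\<close>, and for \<open>h = 0\<close> it is \<open>d \<le> 5 d - 12\<close>. If
  \<open>d = 3\<close> and there is a heavy neighbor, \<open>cubic\<close> leaves it as the only
  recipient, and 3 is exactly the charge available.\<close>

lemma big_vertex_charge:
  assumes d: "3 \<le> card (nb E W v)"
    and star: "card {t \<in> nb E W v. heavy v t} + 1 < card (nb E W v)"
    and cubic: "\<And>a b. card (nb E W v) = 3 \<Longrightarrow> a \<in> nb E W v \<Longrightarrow> b \<in> nb E W v \<Longrightarrow> a \<noteq> b \<Longrightarrow> heavy v a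
      \<Longrightarrow> card (nb E W b) \<noteq> 2"
  shows "(\<Sum>u\<in>nb E W v. transfer v u) \<le> 5 * int (card (nb E W v)) - 12"
proof -
  have fn: "finite (nb E W v)" using fin by (simp add: nb_def)
  define H where "H = {t \<in> nb E W v. heavy v t}"
  have "transfer v u \<le> 1 + (if heavy v u then 2 else 0)" for u by (auto simp: transfer_def)
  then have "(\<Sum>u\<in>nb E W v. transfer v u) \<le> (\<Sum>u\<in>nb E W v. 1 + (if heavy v u then 2 else 0))"
    by (intro sum_mono)
  also have "\<dots> = int (card (nb E W v)) + 2 * int (card H)"
    using fn by (simp add: sum.distrib sum.If_cases H_def Int_def)
  finally have le: "(\<Sum>u\<in>nb E W v. transfer v u) \<le> int (card (nb E W v)) + 2 * int (card H)" .
  show ?thesis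
  proof (cases "4 \<le> card (nb E W v) \<or> H = {}")
    case True
    then show ?thesis using le star d unfolding H_def[symmetric] by (cases "H = {}") auto
  next
    case False
    then obtain a where a: "a \<in> nb E W v" "heavy v a" by (auto simp: H_def)
    have c3: "card (nb E W v) = 3" using False d by auto
    have "(\<Sum>u\<in>nb E W v - {a}. transfer v u) = 0"
      using cubic[OF c3 a(1)] a(2) by (intro sum.neutral) (auto simp: transfer_def)
    then have "(\<Sum>u\<in>nb E W v. transfer v u) = transfer v a" using a(1) fn by (simp add: sum.remove)
    then show ?thesis using transfer_le_3[of v a] c3 by simp
  qed
qed

text \<open>The 2 is the deficit \<open>12 - 5 * 2\<close>. Two large neighbors give 1 each. One
  large neighbor gives 3, of which at most 1 is passed on.\<close>

lemma two_vertex_charge: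
  assumes v: "v \<in> W" and d: "card (nb E W v) = 2"
    and ge2: "\<And>w. w \<in> W \<Longrightarrow> 2 \<le> card (nb E W w)"
    and path: "\<And>a b c e. \<lbrakk>a \<in> nb E W b; c \<in> nb E W b; a \<noteq> c; e \<in> nb E W c; e \<noteq> b; b \<in> W;
      card (nb E W a) = 2; card (nb E W b) = 2; card (nb E W c) = 2; card (nb E W e) = 2\<rbrakk> \<Longrightarrow> False"
  shows "2 + (\<Sum>u\<in>nb E W v. transfer v u) \<le> (\<Sum>u\<in>nb E W v. transfer u v)"
proof -
  obtain x y where xy: "nb E W v = {x, y}" "x \<noteq> y" using d by (auto simp: card_2_iff)
  have W: "x \<in> W" "y \<in> W" using xy by (auto simp: nb_def)
  have vx: "v \<in> nb E W x" "v \<in> nb E W y" using nb_sym[OF v, of x] nb_sym[OF v, of y] xy by auto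
  have sums: "(\<Sum>u\<in>nb E W v. transfer v u) = transfer v x + transfer v y"
    "(\<Sum>u\<in>nb E W v. transfer u v) = transfer x v + transfer y v"
    using xy by simp_all
  have heavy3: "transfer s v = 3" if "nb E W v = {s, t}" "s \<noteq> t" "3 \<le> card (nb E W s)" "card (nb E W t) = 2" for s t
    using that d by (auto simp: transfer_def heavy_def)
  have out1: "transfer v s \<le> 1" for s using d by (simp add: transfer_def)
  have out0: "transfer v s = 0" if "3 \<le> card (nb E W s)" for s using that by (simp add: transfer_def)
  have in1: "1 \<le> transfer s v" if "3 \<le> card (nb E W s)" for s using that d by (simp add: transfer_def)
  have nonneg: "0 \<le> transfer s v" for s by (rule transfer_nonneg)
  consider "3 \<le> card (nb E W x)" "3 \<le> card (nb E W y)"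
    | "3 \<le> card (nb E W x)" "card (nb E W y) = 2" | "card (nb E W x) = 2" "3 \<le> card (nb E W y)"
    | "card (nb E W x) = 2" "card (nb E W y) = 2"
    using ge2[OF W(1)] ge2[OF W(2)] by linarith
  then show ?thesis
  proof cases
    case 1
    then show ?thesis using sums out0[of x] out0[of y] in1[of x] in1[of y] by linarith
  next
    case 2
    then show ?thesis using sums heavy3[OF xy] out0[of x] out1[of y] nonneg[of y] by linarith
  next
    case 3
    then show ?thesis
      using sums heavy3[of y x] xy out0[of y] out1[of x] nonneg[of x] by (simp add: insert_commute)
  next
    case 4
    \<comment> \<open>With both neighbors of degree 2, a further vertex of degree 2 would make four
      in a row. So each neighbor has a large vertex behind it and passes 1 to \<open>v\<close>,
      which itself passes on nothing.\<close>
    have far: "\<exists>w\<in>nb E W s. 3 \<le> card (nb E W w)"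
      if s: "nb E W v = {s, t}" "s \<noteq> t" "card (nb E W s) = 2" "card (nb E W t) = 2" "v \<in> nb E W s" for s t
    proof -
      obtain w where w: "nb E W s = {v, w}" "v \<noteq> w" using card_2_other[OF s(3,5)] by blast
      have "card (nb E W w) \<noteq> 2" using path[of t v s w] s w d v by auto
      moreover have "w \<in> W" using w by (auto simp: nb_def)
      ultimately have "3 \<le> card (nb E W w)" using ge2[of w] by linarith
      then show ?thesis using w by auto
    qed
    have "nb E W v = {y, x}" "y \<noteq> x" using xy by auto
    then have "transfer x v = 1" "transfer y v = 1"
      using far[OF xy 4 vx(1)] far[of y x] 4 vx(2) xy d by (auto simp: transfer_def)
    moreover have "transfer v x = 0" "transfer v y = 0" using 4 xy d by (auto simp: transfer_def)
    ultimately show ?thesis using sums by simp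
  qed
qed

text \<open>Transfers cancel in the total, so the final charges add up to the initial sum, which
  sparsity makes negative; without the four configurations every final charge would be
  nonnegative.\<close>

lemma reducible_configuration_exists:
  assumes "W \<noteq> {}" and sparse: "5 * (\<Sum>v\<in>W. card (nb E W v)) < 12 * card W"
  obtains (leaf) v where "v \<in> W" "card (nb E W v) \<le> 1"
  | (path) a b c e where "a \<in> nb E W b" "c \<in> nb E W b" "a \<noteq> c" "e \<in> nb E W c" "e \<noteq> b" "b \<in> W"
      "card (nb E W a) = 2" "card (nb E W b) = 2" "card (nb E W c) = 2" "card (nb E W e) = 2"
  | (star) v where "v \<in> W" "3 \<le> card (nb E W v)" "card (nb E W v) \<le> card {t \<in> nb E W v. heavy v t} + 1"
  | (cubic) v a b where "v \<in> W" "card (nb E W v) = 3" "a \<in> nb E W v" "b \<in> nb E W v" "a \<noteq> b"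
      "heavy v a" "card (nb E W b) = 2"
proof (rule ccontr)
  assume "\<not> thesis"
  note no = leaf path star cubic
  have ge2: "2 \<le> card (nb E W v)" if "v \<in> W" for v
    using no(1)[OF that] \<open>\<not> thesis\<close> by force
  have "0 \<le> 5 * int (card (nb E W v)) - 12 + (\<Sum>u\<in>nb E W v. transfer u v) - (\<Sum>u\<in>nb E W v. transfer v u)"
    if v: "v \<in> W" for v
  proof (cases "card (nb E W v) = 2")
    case True
    have "2 + (\<Sum>u\<in>nb E W v. transfer v u) \<le> (\<Sum>u\<in>nb E W v. transfer u v)"
      using two_vertex_charge[OF v True ge2] no(2) \<open>\<not> thesis\<close> by metis
    then show ?thesis using True by simp
  next
    case False
    then have d: "3 \<le> card (nb E W v)" using ge2[OF v] by linarith
    have "(\<Sum>u\<in>nb E W v. transfer v u) \<le> 5 * int (card (nb E W v)) - 12"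
    proof (rule big_vertex_charge[OF d])
      show "card {t \<in> nb E W v. heavy v t} + 1 < card (nb E W v)"
        using no(3)[OF v d] \<open>\<not> thesis\<close> by force
      show "card (nb E W b) \<noteq> 2"
        if "card (nb E W v) = 3" "a \<in> nb E W v" "b \<in> nb E W v" "a \<noteq> b" "heavy v a" for a b
        using no(4)[OF v that] \<open>\<not> thesis\<close> by blast
    qed
    moreover have "0 \<le> (\<Sum>u\<in>nb E W v. transfer u v)" by (intro sum_nonneg transfer_nonneg)
    ultimately show ?thesis by linarith
  qed
  then have "0 \<le> (\<Sum>v\<in>W. 5 * int (card (nb E W v)) - 12 + (\<Sum>u\<in>nb E W v. transfer u v) - (\<Sum>u\<in>nb E W v. transfer v u))"
    by (rule sum_nonneg)
  also have "\<dots> = 5 * (\<Sum>v\<in>W. int (card (nb E W v))) - 12 * int (card W)"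
    using transfer_sum_swap by (simp add: sum.distrib sum_subtractf sum_distrib_left)
  finally have "12 * card W \<le> 5 * (\<Sum>v\<in>W. card (nb E W v))"
    by (simp flip: of_nat_sum)
  then show False using sparse by simp
qed

section \<open>Degree sums and edges of an induced subgraph\<close>

lemma card_nb_incident:
  assumes "v \<in> W"
  shows "card (nb E W v) = card {e \<in> {e \<in> E. e \<subseteq> W}. v \<in> e}"
proof -
  have "bij_betw (\<lambda>u. {v, u}) (nb E W v) {e \<in> {e \<in> E. e \<subseteq> W}. v \<in> e}"
    unfolding bij_betw_def
  proof
    show "inj_on (\<lambda>u. {v, u}) (nb E W v)" by (auto simp: inj_on_def doubleton_eq_iff)
    have "e \<in> (\<lambda>u. {v, u}) ` nb E W v" if e: "e \<in> E" "e \<subseteq> W" "v \<in> e" for e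
    proof -
      obtain u where "e = {v, u}" using card_2_other[OF card2[OF e(1)] e(3)] by blast
      then show ?thesis using e by (auto simp: nb_def)
    qed
    then show "(\<lambda>u. {v, u}) ` nb E W v = {e \<in> {e \<in> E. e \<subseteq> W}. v \<in> e}"
      using assms by (auto simp: nb_def)
  qed
  then show ?thesis by (rule bij_betw_same_card)
qed

lemma sum_card_nb: "(\<Sum>v\<in>W. card (nb E W v)) = 2 * card {e \<in> E. e \<subseteq> W}"
proof -
  have "finite {e \<in> E. e \<subseteq> W}" by (rule finite_subset[of _ "Pow W"]) (use fin in auto)
  moreover have "\<forall>e\<in>{e \<in> E. e \<subseteq> W}. card {v \<in> W. v \<in> e} = 2"
  proof
    fix e assume e: "e \<in> {e \<in> E. e \<subseteq> W}"
    then have "{v \<in> W. v \<in> e} = e" by auto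
    then show "card {v \<in> W. v \<in> e} = 2" using card2 e by simp
  qed
  ultimately have "(\<Sum>v\<in>W. card {e \<in> {e \<in> E. e \<subseteq> W}. v \<in> e}) = 2 * card {e \<in> E. e \<subseteq> W}"
    using sum_multicount_gen[OF fin, of "{e \<in> E. e \<subseteq> W}" "\<lambda>v e. v \<in> e" "\<lambda>_. 2"] by simp
  then show ?thesis using card_nb_incident by simp
qed

end

text \<open>Induction on the vertex set. Sparsity is assumed for every nonempty subset because
  discharging takes place in the current \<open>W\<close>, with the degrees inside
  \<open>W\<close>.\<close>

theorem sparse_pcf_choosable:
  fixes E :: "'a set set"
  assumes "finite V" and card2: "\<And>e. e \<in> E \<Longrightarrow> card e = 2" and girth: "\<And>p. cyc E p \<Longrightarrow> 7 \<le> length p"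
    and sparse: "\<And>W. W \<subseteq> V \<Longrightarrow> W \<noteq> {} \<Longrightarrow> 5 * (\<Sum>v\<in>W. card (nb E W v)) < 12 * card W"
  shows "pcf_choosable TYPE('c) E V"
proof -
  have "pcf_choosable TYPE('c) E W" if "W \<subseteq> V" for W
    using that
  proof (induction "card W" arbitrary: W rule: less_induct)
    case less
    have fin: "finite W" using less.prems assms(1) by (rule finite_subset)
    have IH: "pcf_choosable TYPE('c) E (W - S)" if "s \<in> S" "s \<in> W" for s S
    proof (rule less.hyps)
      show "card (W - S) < card W" using that fin by (intro psubset_card_mono) auto
    qed (use less.prems in auto)
    note other = card_2_other
    show ?case
    proof (cases "W = {}")
      case True
      then show ?thesis by (simp add: pcf_choosable_def pcf_def)
    next
      case False
      show ?thesis
      proof (rule reducible_configuration_exists[OF fin card2 False sparse[OF less.prems False]])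
        fix v assume "v \<in> W" "card (nb E W v) \<le> 1"
        then show ?thesis using reducible_leaf[OF fin card2] IH[of v "{v}"] by blast
      next
        fix a b c e
        assume p: "a \<in> nb E W b" "c \<in> nb E W b" "a \<noteq> c" "e \<in> nb E W c" "e \<noteq> b" "b \<in> W"
          "card (nb E W a) = 2" "card (nb E W b) = 2" "card (nb E W c) = 2" "card (nb E W e) = 2"
        have W: "a \<in> W" "c \<in> W" "e \<in> W" using p by (auto simp: nb_def)
        have "b \<in> nb E W a" "b \<in> nb E W c" "c \<in> nb E W e" using p W nb_sym by metis+
        then obtain x y where xy: "nb E W a = {b, x}" "b \<noteq> x" "nb E W e = {c, y}" "c \<noteq> y"
          using other p by metis
        have na: "nb E W a = {x, b}" "x \<noteq> b" using xy by auto
        have nbb: "nb E W b = {a, c}" using other[OF p(8,1)] p(2,3) by auto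
        have nc: "nb E W c = {b, e}" using other[OF p(9) \<open>b \<in> nb E W c\<close>] p(4,5) by auto
        have "b \<noteq> e" using p(5) by simp
        show ?thesis
          by (rule reducible_path[OF fin card2 girth W(1) p(6) W(2,3) na nbb p(3) nc \<open>b \<noteq> e\<close> xy(3,4)
                IH[of a "{a, b, c, e}"]]) (use W in simp_all)
      next
        fix v assume v: "v \<in> W" "3 \<le> card (nb E W v)"
          and star: "card (nb E W v) \<le> card {t \<in> nb E W v. heavy E W v t} + 1"
        define H where "H = {t \<in> nb E W v. heavy E W v t}"
        have fn: "finite (nb E W v)" using fin by (simp add: nb_def)
        have HN: "H \<subseteq> nb E W v" "card (nb E W v) \<le> card H + 1" using star by (auto simp: H_def)
        then have "card (nb E W v - H) \<le> 1" using fn by (simp add: card_Diff_subset finite_subset)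
        \<comment> \<open>At most one neighbor is not heavy, and \<open>y\<close> is that one. If
          all are heavy, any neighbor may play the part of \<open>y\<close>.\<close>
        have "\<exists>y\<in>nb E W v. nb E W v - {y} \<subseteq> H"
        proof (cases "H = nb E W v")
          case True
          then show ?thesis using v(2) by (metis Diff_subset card.empty ex_in_conv not_numeral_le_zero)
        next
          case False
          then obtain y where y: "y \<in> nb E W v - H" using HN by auto
          have "\<forall>a\<in>nb E W v - H. \<forall>b\<in>nb E W v - H. a = b"
            using \<open>card (nb E W v - H) \<le> 1\<close> card_le_Suc0_iff_eq[of "nb E W v - H"] fn by simp
          then show ?thesis using y by blast
        qed
        then obtain y where y: "y \<in> nb E W v" "nb E W v - {y} \<subseteq> H" by blast
        define T where "T = nb E W v - {y}"
        have nv: "nb E W v = insert y T" "y \<notin> T" using y by (auto simp: T_def)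
        have T2: "2 \<le> card T" using v(2) y(1) fn by (simp add: T_def)
        have "\<exists>q h. nb E W t = {v, q} \<and> v \<noteq> q \<and> nb E W q = {t, h} \<and> t \<noteq> h" if t: "t \<in> T" for t
        proof -
          have h: "t \<in> nb E W v" "heavy E W v t" using t y(2) by (auto simp: T_def H_def)
          then obtain q where q: "q \<in> nb E W t" "q \<noteq> v" "card (nb E W q) = 2" "card (nb E W t) = 2"
            by (auto simp: heavy_def[OF fin card2])
          have tW: "t \<in> W" using h(1) by (auto simp: nb_def)
          have "v \<in> nb E W t" using nb_sym[OF v(1) h(1)] .
          then have "nb E W t = {v, q}" using other[OF q(4)] q(1,2) by auto
          moreover obtain h where "nb E W q = {t, h}" "t \<noteq> h"
            using other[OF q(3)] nb_sym[OF tW q(1)] by blast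
          ultimately show ?thesis using q(2) by blast
        qed
        then obtain q h where qh: "\<And>t. t \<in> T \<Longrightarrow> nb E W t = {v, q t} \<and> v \<noteq> q t"
          "\<And>t. t \<in> T \<Longrightarrow> nb E W (q t) = {t, h t} \<and> t \<noteq> h t"
          by metis
        show ?thesis
          by (rule reducible_star[OF fin card2 girth v(1) nv T2 qh IH[of v]]) (use v(1) in auto)
      next
        fix v a b
        assume v: "v \<in> W" "card (nb E W v) = 3" "a \<in> nb E W v" "b \<in> nb E W v" "a \<noteq> b"
          and a: "heavy E W v a" and b: "card (nb E W b) = 2"
        have W: "a \<in> W" "b \<in> W" using v by (auto simp: nb_def)
        have va: "v \<in> nb E W a" "v \<in> nb E W b" using nb_sym[OF v(1)] v(3,4) by auto
        have "card (nb E W v - {a, b}) = 1" using v by (simp add: card_Diff_subset)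
        then obtain y where "nb E W v - {a, b} = {y}" by (auto simp: card_1_singleton_iff)
        then have nv: "nb E W v = {a, b, y}" "distinct [a, b, y]" using v by auto
        obtain q where q: "q \<in> nb E W a" "q \<noteq> v" "card (nb E W q) = 2" "card (nb E W a) = 2"
          using a by (auto simp: heavy_def[OF fin card2])
        have na: "nb E W a = {v, q}" "v \<noteq> q" using other[OF q(4) va(1)] q(1,2) by auto
        obtain x where nq: "nb E W q = {a, x}" "a \<noteq> x"
          using other[OF q(3)] nb_sym[OF W(1) q(1)] by blast
        obtain z where nz: "nb E W b = {v, z}" "v \<noteq> z" using other[OF b va(2)] by blast
        show ?thesis
          by (rule reducible_cubic[OF fin card2 girth v(1) nv na nq nz IH[of v "{v, a, q, b}"]])
            (use v(1) in simp_all)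
      qed
    qed
  qed
  then show ?thesis by simp
qed

section \<open>Planar graphs of girth at least 12\<close>

context
  fixes G :: "'a pair_pre_digraph"
  assumes G: "pair_graph G"
begin

lemma parcs_sym: "(u, v) \<in> parcs G \<Longrightarrow> (v, u) \<in> parcs G"
proof -
  interpret pair_graph G by (rule G)
  show "(u, v) \<in> parcs G \<Longrightarrow> (v, u) \<in> parcs G"
    using pair_sym_arcs by (auto simp: symmetric_def sym_def)
qed

lemma doubleton_in_edges: "{u, v} \<in> edges G \<longleftrightarrow> (u, v) \<in> parcs G"
  using parcs_sym by (auto simp: edges_def doubleton_eq_iff)

lemma parcs_verts: "(u, v) \<in> parcs G \<Longrightarrow> u \<in> pverts G \<and> v \<in> pverts G \<and> u \<noteq> v"
proof -
  interpret pair_graph G by (rule G)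
  show "(u, v) \<in> parcs G \<Longrightarrow> u \<in> pverts G \<and> v \<in> pverts G \<and> u \<noteq> v"
    using in_arcsD1 in_arcsD2 pair_no_loops by fastforce
qed

lemma edges_pair_graph:
  assumes "e \<in> edges G"
  shows "e \<subseteq> pverts G" "card e = 2"
proof -
  obtain u v where uv: "e = {u, v}" "(u, v) \<in> parcs G" using assms by (auto simp: edges_def)
  then show "e \<subseteq> pverts G" "card e = 2" using parcs_verts[OF uv(2)] by simp_all
qed

lemma neighborhood_eq_nb: "neighborhood G v = nb (edges G) (pverts G) v"
  using parcs_verts by (auto simp: neighborhood_def nb_def doubleton_in_edges)

lemma vwalk_arcs_pedges:
  assumes "q \<noteq> []" "pedges q \<subseteq> edges G"
  shows "set (vwalk_arcs q) \<subseteq> parcs G \<and> pcas (hd q) (vwalk_arcs q) (last q) \<and>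
    pawalk_verts (hd q) (vwalk_arcs q) = q"
  using assms
proof (induction q rule: pedges.induct)
  case (1 x y zs)
  then show ?case by (simp add: doubleton_in_edges)
qed auto

text \<open>\<open>cyc\<close> lists vertices while the cycles behind \<open>girth\<close> list
  arcs. The closed list \<open>p @ [hd p]\<close> has as many arcs as \<open>p\<close> has vertices,
  so the length and its lower bound 3 carry over.\<close>

lemma girth_le_cyc:
  assumes "cyc (edges G) p"
  shows "girth G \<le> enat (length p)"
proof -
  define q where "q = p @ [hd p]"
  have p: "3 \<le> length p" "distinct p" and q: "q \<noteq> []" "pedges q \<subseteq> edges G"
    using assms by (auto simp: cyc_def q_def)
  have hd: "hd q = hd p" "last q = hd p" using p by (cases p; simp add: q_def)+
  note walk = vwalk_arcs_pedges[OF q, unfolded hd]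
  have "length (vwalk_arcs q) + 1 = length q" using q(1) by (induction q rule: vwalk_arcs.induct) auto
  then have len: "length (vwalk_arcs q) = length p" by (simp add: q_def)
  have "hd p \<in> \<Union> (pedges q)" using Union_pedges[of q] p by (cases p) (auto simp: q_def)
  then have "hd p \<in> pverts G" using q(2) edges_pair_graph(1) by blast
  then have "pre_digraph.awalk (with_proj G) (hd p) (vwalk_arcs q) (hd p)"
    using walk by (simp add: pre_digraph.awalk_def cas_with_proj_eq)
  moreover have "distinct (tl q)" using p by (cases p) (auto simp: q_def)
  moreover have "vwalk_arcs q \<noteq> []" using len p by auto
  ultimately have "pre_digraph.cycle (with_proj G) (vwalk_arcs q)"
    using walk by (auto simp: pre_digraph.cycle_def awalk_verts_with_proj_eq)
  then have "girth G \<le> enat (length (vwalk_arcs q))"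
    unfolding girth_def using len p by (intro INF_lower) auto
  then show ?thesis by (simp add: len)
qed

lemma plane_drawing_plane_graph:
  assumes "plane_drawing G pos \<gamma>"
  shows "plane_graph (pverts G) (edges G) pos \<gamma>"
proof -
  have "finite (pverts G)"
    using G by (simp add: pair_graph_def pair_digraph_def pair_fin_digraph_def pair_fin_digraph_axioms_def)
  then show ?thesis
    using assms edges_pair_graph unfolding plane_graph_def plane_drawing_def by simp
qed

end

theorem theorem1p8:
  fixes G :: "'a pair_pre_digraph"
  assumes "pair_graph G"
    and "planar G"
    and "girth G \<ge> 12"
  shows "pcf_degree_plus_choosable TYPE('c) 2 G"
proof -
  let ?V = "pverts G" and ?E = "edges G"
  obtain pos \<gamma> where pg: "plane_graph ?V ?E pos \<gamma>"
    using assms(2) plane_drawing_plane_graph[OF assms(1)] unfolding planar_def by blast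
  have fin: "finite ?V" by (rule pg_finV[OF pg])
  have card2: "card e = 2" if "e \<in> ?E" for e using edges_pair_graph(2)[OF assms(1) that] .
  have girth: "12 \<le> length p" if "cyc ?E p" for p
  proof -
    have "12 \<le> enat (length p)" using assms(3) girth_le_cyc[OF assms(1) that] by (rule order_trans)
    then show ?thesis by (simp add: numeral_eq_enat)
  qed
  \<comment> \<open>The subgraph induced by \<open>W\<close> inherits drawing and girth. Its degree
    sum is \<open>2 * card F\<close>, and \<open>10 * card F + 12 \<le> 12 * card W\<close> makes
    the inequality strict.\<close>
  have sparse: "5 * (\<Sum>v\<in>W. card (nb ?E W v)) < 12 * card W" if W: "W \<subseteq> ?V" "W \<noteq> {}" for W
  proof -
    define F where "F = {e \<in> ?E. e \<subseteq> W}"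
    have "plane_graph W F pos \<gamma>"
      by (rule plane_graph_subset[OF pg W(1)]) (auto simp: F_def)
    moreover have "12 \<le> length p" if "cyc F p" for p
      using girth[OF cyc_mono[OF that]] by (auto simp: F_def)
    ultimately have "(int 12 - 2) * int (card F) + int 12 \<le> int 12 * int (card W)"
      using plane_graph_edge_bound[of W F pos \<gamma> 12] W(2) by auto
    moreover have "(\<Sum>v\<in>W. card (nb ?E W v)) = 2 * card F"
      unfolding F_def by (rule sum_card_nb[OF finite_subset[OF W(1) fin] card2])
    ultimately show ?thesis by simp
  qed
  have choosable: "pcf_choosable TYPE('c) ?E ?V"
    by (rule sparse_pcf_choosable[OF fin card2 _ sparse]) (use girth in force)+
  show ?thesis
    unfolding pcf_degree_plus_choosable_def
  proof (intro allI impI)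
    fix L :: "'a \<Rightarrow> 'c set"
    assume "\<forall>v\<in>?V. finite (L v) \<and> card (L v) = degree G v + 2"
    then have "large_lists ?E ?V L"
      by (simp add: large_lists_def degree_def neighborhood_eq_nb[OF assms(1)])
    then obtain \<phi> where \<phi>: "pcf ?E ?V \<phi>" "\<forall>v\<in>?V. \<phi> v \<in> L v"
      using choosable unfolding pcf_choosable_def by blast
    have "proper_coloring G \<phi>"
      unfolding proper_coloring_def
    proof clarify
      fix u v assume uv: "(u, v) \<in> parcs G" and eq: "\<phi> u = \<phi> v"
      have "u \<in> ?V" "v \<in> nb ?E ?V u"
        using parcs_verts[OF assms(1) uv] uv neighborhood_eq_nb[OF assms(1), of u]
        by (auto simp: neighborhood_def)
      then show False using \<phi>(1) eq unfolding pcf_def by metis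
    qed
    then have "proper_conflict_free_coloring G \<phi>"
      using \<phi>(1) by (simp add: proper_conflict_free_coloring_def pcf_def neighborhood_eq_nb[OF assms(1)])
    then show "\<exists>\<phi>. proper_conflict_free_coloring G \<phi> \<and> (\<forall>v\<in>?V. \<phi> v \<in> L v)"
      using \<phi>(2) by blast
  qed
qed

end
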